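(* Let $\mathcal H\subset\mathbb R^2$ be a nonempty bounded open set with $B_2(0)\subset\mathcal H\subset B_{\mathcal R}(0)$ for some $\mathcal R\in(2,\infty)$. Let $J\in C^2_c(\mathbb R^2)$ be radially symmetric with $J(x)>0$ if $|x|<d$, $J(x)=0$ if $|x|\ge d$ (for some $d>0$), and $\int_{\mathbb R^2}J=1$. Let $u_0\ge0$ with $u_0=0$ in $\mathcal H$ and $u_0\in L^\infty(\mathbb R^2)\cap L^1(\mathbb R^2,\log|x|\,dx)$. Let $u$ be the solution of the nonlocal exterior problem with hole $\mathcal H$ and initial datum $u_0$. Then there exist constants $t_0>1$ and $C_1>0$ such that $$u(x,t)\le\frac{C_1}{t\log t}\quad\text{for }x\in\mathbb R^2,\ t\ge t_0.$$
   Context: $L$ is the operator $Lg:=J*g-g$. The solution $u\in C([0,\infty);L^1(\mathbb R^2))$ is the unique solution of: $\partial_tu=Lu$ in $(\mathbb R^2\setminus\mathcal H)\times(0,\infty)$, $u=0$ in $\mathcal H\times(0,\infty)$, $u(\cdot,0)=u_0$ in $\mathbb R^2$. Pointwise statements in $x$ involving $u(\cdot,t)$ are understood up to null sets. *)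

theory Defs
  imports "HOL-Analysis.Analysis"
begin

definition C2_compact_support :: "('a::euclidean_space \<Rightarrow> real) \<Rightarrow> bool" where
  "C2_compact_support f \<longleftrightarrow>
     (\<exists>(f' :: 'a \<Rightarrow> 'a \<Rightarrow>\<^sub>L real) (f'' :: 'a \<Rightarrow> 'a \<Rightarrow>\<^sub>L 'a \<Rightarrow>\<^sub>L real).
        (\<forall>x. (f has_derivative blinfun_apply (f' x)) (at x)) \<and>
        (\<forall>x. (f' has_derivative blinfun_apply (f'' x)) (at x)) \<and>
        continuous_on UNIV f'') \<and>
     compact (closure {x. f x \<noteq> 0})"

definition radially_symmetric :: "('a::real_normed_vector \<Rightarrow> real) \<Rightarrow> bool" where
  "radially_symmetric f \<longleftrightarrow> (\<forall>x y. norm x = norm y \<longrightarrow> f x = f y)"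

definition convolve :: "('a::euclidean_space \<Rightarrow> real) \<Rightarrow> ('a \<Rightarrow> real) \<Rightarrow> 'a \<Rightarrow> real" where
  "convolve J g x = (LINT y|lebesgue. J (x - y) * g y)"

definition nonlocal_op :: "('a::euclidean_space \<Rightarrow> real) \<Rightarrow> ('a \<Rightarrow> real) \<Rightarrow> 'a \<Rightarrow> real" where
  "nonlocal_op J g x = convolve J g x - g x"

text \<open>The L1 norm over \<open>A\<close> takes values in \<^typ>\<open>ennreal\<close>, so that it is infinite, rather
  than zero by convention, on functions that are not integrable.\<close>

definition L1_norm_on :: "'a::euclidean_space set \<Rightarrow> ('a \<Rightarrow> real) \<Rightarrow> ennreal" where
  "L1_norm_on A f = (\<integral>\<^sup>+x\<in>A. ennreal \<bar>f x\<bar> \<partial>lebesgue)"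

text \<open>A curve in L1 is represented by a function \<open>u\<close> for which each \<open>u t\<close> is a representative
  of the value at time \<open>t\<close>. Only times \<open>t \<ge> 0\<close> matter.\<close>

definition L1_continuous_curve :: "(real \<Rightarrow> 'a::euclidean_space \<Rightarrow> real) \<Rightarrow> bool" where
  "L1_continuous_curve u \<longleftrightarrow>
     (\<forall>t\<ge>0. integrable lebesgue (u t)) \<and>
     (\<forall>t\<ge>0. ((\<lambda>s. L1_norm_on UNIV (\<lambda>x. u s x - u t x)) \<longlongrightarrow> 0) (at t within {0..}))"

text \<open>At time \<open>t\<close>, the curve \<open>u\<close> restricted to \<open>A\<close> has time derivative \<open>v\<close> in L1 of \<open>A\<close>.\<close>

definition has_L1_time_derivative_on ::
  "'a::euclidean_space set \<Rightarrow> (real \<Rightarrow> 'a \<Rightarrow> real) \<Rightarrow> ('a \<Rightarrow> real) \<Rightarrow> real \<Rightarrow> bool" where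
  "has_L1_time_derivative_on A u v t \<longleftrightarrow>
     ((\<lambda>h. L1_norm_on A (\<lambda>x. (u (t + h) x - u t x) / h - v x)) \<longlongrightarrow> 0) (at 0)"

text \<open>The equation is understood in the sense of L1-valued curves. Since \<open>u\<close> is continuous
  into L1, so is its image under \<^const>\<open>nonlocal_op\<close>; hence asking for the time derivative
  pointwise in \<open>x\<close> (for almost every \<open>x\<close> and all \<open>t > 0\<close>) or in the sense of distributions
  singles out the same curves, up to the choice of representatives.\<close>

definition solves_exterior_problem ::
  "('a::euclidean_space \<Rightarrow> real) \<Rightarrow> 'a set \<Rightarrow> ('a \<Rightarrow> real) \<Rightarrow> (real \<Rightarrow> 'a \<Rightarrow> real) \<Rightarrow> bool" where
  "solves_exterior_problem J H u0 u \<longleftrightarrow>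
     L1_continuous_curve u \<and>
     (\<forall>t>0. has_L1_time_derivative_on (- H) u (nonlocal_op J (u t)) t) \<and>
     (\<forall>t>0. AE x in lebesgue. x \<in> H \<longrightarrow> u t x = 0) \<and>
     (AE x in lebesgue. u 0 x = u0 x)"

definition essentially_bounded :: "('a::euclidean_space \<Rightarrow> real) \<Rightarrow> bool" where
  "essentially_bounded f \<longleftrightarrow>
     f \<in> borel_measurable lebesgue \<and> (\<exists>M. AE x in lebesgue. \<bar>f x\<bar> \<le> M)"

text \<open>The logarithmic weight is negative on the unit ball. This is immaterial below, where
  \<open>f\<close> vanishes almost everywhere in the ball of radius 2.\<close>

definition log_weighted_integrable :: "('a::euclidean_space \<Rightarrow> real) \<Rightarrow> bool" where
  "log_weighted_integrable f \<longleftrightarrow>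
     f \<in> borel_measurable lebesgue \<and> integrable lebesgue (\<lambda>x. f x * ln (norm x))"

end

theory Submission
  imports Defs
begin

text \<open>
  Testing the solution against bounded functions \<open>\<phi>\<close> turns the equation into the expansion
  \<open>\<integral> u(t) \<phi> = exp (- (t - s)) \<Sum>\<^sub>k (t - s)^k / k! \<integral> u(s) P^k \<phi>\<close>, where \<open>P\<close> is one step of the random walk
  with jump density \<open>J\<close> that is killed in the hole. Comparison principles are read off from it.

  Smoothing: \<open>P^k\<close> is dominated by the \<open>k\<close>-th convolution power of \<open>J\<close>, whose density is at most
  \<open>C / k\<close>. For this a multiple of the uniform density of a square is split off from \<open>J\<close>, which
  reduces the bound to central binomial coefficients. Hence
  \<open>sup u(t) \<le> K exp (- t / 2) + C M(t / 2) / t\<close> for the mass \<open>M\<close>.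

  Mass: a function equal to \<open>ln \<bar>x\<bar> + A\<close> outside the hole is a supersolution, even after truncation
  at a constant; far away because \<open>ln \<bar>x\<bar>\<close> satisfies the mean value property, near the hole because of
  absorption. So the mass outside the ball of radius \<open>\<rho>\<close> is at most \<open>L / ln \<rho>\<close>, and the mass inside
  is controlled by the smoothing bound. With \<open>\<rho>\<^sup>2 = \<delta> t\<close> and \<open>\<delta>\<close> small this gives
  \<open>M(t) \<le> M(t / 2) / 4 + C / ln t\<close>, hence \<open>M(t) = O(1 / ln t)\<close>, and the smoothing bound concludes.
\<close>

section \<open>Correlation with a kernel\<close>

text \<open>The rate is a product of two effects: \<open>1 / t\<close> is the sup decay of a planar
  diffusion of given mass, and \<open>1 / ln t\<close> is the mass that a recurrent planar walk has
  not yet lost to the hole. The smoothing bound needs the mass at an earlier time and the mass bound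
  needs the sup, so the argument closes as a recursion from \<open>t / 2\<close> to
  \<open>t\<close>. Its factor 1/4 leaves room for \<open>ln t \<le> 2 * ln (t / 2)\<close>: the
  product \<open>M(t) * ln t\<close> still contracts by 1/2. The operator does not regularise: with
  probability \<open>exp (- t)\<close> the walk has not jumped by time \<open>t\<close>, and this
  part keeps the datum as it is. The boundedness of the datum controls it. The expansion needs a
  remainder bound uniform in \<open>k\<close>, hence bounded test functions; this is why the
  logarithm must be truncated. Testing also avoids evaluating the solution at a fixed
  \<open>x\<close>, where the L1 equation says nothing.\<close>

lemma nn_integral_lborel_shift:
  fixes f :: "'a::euclidean_space \<Rightarrow> ennreal"
  assumes [measurable]: "f \<in> borel_measurable borel"
  shows "(\<integral>\<^sup>+y. f (c + y) \<partial>lborel) = (\<integral>\<^sup>+y. f y \<partial>lborel)"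
proof -
  have "(\<integral>\<^sup>+y. f y \<partial>lborel) = (\<integral>\<^sup>+y. f y \<partial>distr lborel borel ((+) c))"
    by (simp only: lborel_distr_plus)
  also have "\<dots> = (\<integral>\<^sup>+y. f (c + y) \<partial>lborel)"
    by (subst nn_integral_distr) auto
  finally show ?thesis ..
qed

text \<open>With values in \<open>ennreal\<close>, Tonelli applies without integrability conditions.
  The argument is \<open>x + y\<close> because the kernel acts on test functions: this is the
  transpose of convolution with \<open>k\<close>.\<close>

definition correlate :: "('a::euclidean_space \<Rightarrow> ennreal) \<Rightarrow> ('a \<Rightarrow> ennreal) \<Rightarrow> 'a \<Rightarrow> ennreal" where
  "correlate k f x = (\<integral>\<^sup>+y. k y * f (x + y) \<partial>lborel)"

lemma measurable_correlate [measurable]: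
  assumes [measurable]: "k \<in> borel_measurable borel" "f \<in> borel_measurable borel"
  shows "correlate k f \<in> borel_measurable borel"
  unfolding correlate_def by measurable

lemma measurable_correlate_funpow [measurable]:
  assumes [measurable]: "k \<in> borel_measurable borel" "f \<in> borel_measurable borel"
  shows "(correlate k ^^ n) f \<in> borel_measurable borel"
  by (induction n) auto

lemma correlate_mono:
  assumes "\<And>y. f y \<le> g y" 
  shows "correlate k f x \<le> correlate k g x"
  unfolding correlate_def by (intro nn_integral_mono mult_left_mono assms) auto

lemma correlate_shift:
  assumes [measurable]: "k \<in> borel_measurable borel" "f \<in> borel_measurable borel"
  shows "correlate (\<lambda>y. k (y - z)) f x = correlate k f (x + z)"
  using nn_integral_lborel_shift[of "\<lambda>y. k (y - z) * f (x + y)" z]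
  by (simp add: correlate_def add.assoc)

lemma correlate_add:
  assumes [measurable]: "k \<in> borel_measurable borel" "f \<in> borel_measurable borel" "g \<in> borel_measurable borel"
  shows "correlate k (\<lambda>y. f y + g y) x = correlate k f x + correlate k g x"
  unfolding correlate_def by (simp add: distrib_left nn_integral_add)

lemma correlate_add_left:
  assumes [measurable]: "k \<in> borel_measurable borel" "l \<in> borel_measurable borel" "f \<in> borel_measurable borel"
  shows "correlate (\<lambda>y. k y + l y) f x = correlate k f x + correlate l f x"
  unfolding correlate_def by (simp add: distrib_right nn_integral_add)

lemma correlate_cmult:
  assumes [measurable]: "k \<in> borel_measurable borel" "f \<in> borel_measurable borel"
  shows "correlate k (\<lambda>y. c * f y) x = c * correlate k f x"
  unfolding correlate_def by (subst nn_integral_cmult[symmetric]) (auto simp: mult_ac)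

lemma correlate_cmult_left:
  assumes [measurable]: "k \<in> borel_measurable borel" "f \<in> borel_measurable borel"
  shows "correlate (\<lambda>y. c * k y) f x = c * correlate k f x"
  unfolding correlate_def by (subst nn_integral_cmult[symmetric]) (auto simp: mult_ac)

lemma correlate_commute:
  assumes [measurable]: "k \<in> borel_measurable borel" "l \<in> borel_measurable borel" "f \<in> borel_measurable borel"
  shows "correlate k (correlate l f) x = correlate l (correlate k f) x"
proof -
  have "correlate k (correlate l f) x = (\<integral>\<^sup>+y. \<integral>\<^sup>+z. k y * l z * f (x + y + z) \<partial>lborel \<partial>lborel)"
    unfolding correlate_def by (subst nn_integral_cmult[symmetric]) (auto simp: mult_ac)
  also have "\<dots> = (\<integral>\<^sup>+z. \<integral>\<^sup>+y. k y * l z * f (x + y + z) \<partial>lborel \<partial>lborel)"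
    by (rule lborel_pair.Fubini') measurable
  also have "\<dots> = correlate l (correlate k f) x"
    unfolding correlate_def by (subst nn_integral_cmult[symmetric]) (auto simp: ac_simps)
  finally show ?thesis .
qed

lemma correlate_funpow_commute:
  assumes [measurable]: "k \<in> borel_measurable borel" "l \<in> borel_measurable borel" "f \<in> borel_measurable borel"
  shows "correlate k ((correlate l ^^ n) f) = (correlate l ^^ n) (correlate k f)"
proof (induction n)
  case (Suc n)
  have "correlate k ((correlate l ^^ Suc n) f) = correlate l (correlate k ((correlate l ^^ n) f))"
    by (intro ext) (simp add: correlate_commute)
  with Suc show ?case by simp
qed simp

lemma nn_integral_correlate:
  assumes [measurable]: "k \<in> borel_measurable borel" "f \<in> borel_measurable borel"
  shows "(\<integral>\<^sup>+x. correlate k f x \<partial>lborel) = (\<integral>\<^sup>+y. k y \<partial>lborel) * (\<integral>\<^sup>+x. f x \<partial>lborel)"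
proof -
  have "(\<integral>\<^sup>+x. correlate k f x \<partial>lborel) = (\<integral>\<^sup>+y. \<integral>\<^sup>+x. k y * f (x + y) \<partial>lborel \<partial>lborel)"
    unfolding correlate_def by (rule lborel_pair.Fubini') measurable
  also have "\<dots> = (\<integral>\<^sup>+y. k y * (\<integral>\<^sup>+x. f x \<partial>lborel) \<partial>lborel)"
  proof (rule nn_integral_cong)
    fix y :: 'a
    show "(\<integral>\<^sup>+x. k y * f (x + y) \<partial>lborel) = k y * (\<integral>\<^sup>+x. f x \<partial>lborel)"
      using nn_integral_lborel_shift[of f y] by (simp add: nn_integral_cmult add.commute)
  qed
  finally show ?thesis by (simp add: nn_integral_multc)
qed

lemma correlate_le_const:
  assumes [measurable]: "k \<in> borel_measurable borel" "f \<in> borel_measurable borel"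
    and "\<And>y. k y \<le> C"
  shows "correlate k f x \<le> C * (\<integral>\<^sup>+y. f y \<partial>lborel)"
proof -
  have "correlate k f x \<le> (\<integral>\<^sup>+y. C * f (x + y) \<partial>lborel)"
    unfolding correlate_def by (intro nn_integral_mono mult_right_mono assms) auto
  also have "\<dots> = C * (\<integral>\<^sup>+y. f y \<partial>lborel)"
    by (simp add: nn_integral_cmult nn_integral_lborel_shift)
  finally show ?thesis .
qed

lemma correlate_funpow_add:
  assumes [measurable]: "k \<in> borel_measurable borel" "f \<in> borel_measurable borel" "g \<in> borel_measurable borel"
  shows "(correlate k ^^ n) (\<lambda>y. c * f y + g y) x = c * (correlate k ^^ n) f x + (correlate k ^^ n) g x"
proof (induction n arbitrary: x)
  case (Suc n)
  have "(correlate k ^^ n) (\<lambda>y. c * f y + g y) = (\<lambda>x. c * (correlate k ^^ n) f x + (correlate k ^^ n) g x)"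
    using Suc by auto
  then show ?case
    by (simp add: correlate_add correlate_cmult)
qed simp

text \<open>Splitting off a well-understood part \<open>u\<close> of the kernel. The induction on \<open>k\<close> moves one factor
  of \<open>J = p u + q\<close> at a time into the power of \<open>u\<close>; the rate \<open>p / 2\<close> instead of \<open>p\<close> absorbs the
  convexity of \<open>1 / y\<close>.\<close>

lemma correlate_funpow_split_bound:
  fixes J u q :: "'a::euclidean_space \<Rightarrow> ennreal"
  assumes [measurable]: "u \<in> borel_measurable borel" "q \<in> borel_measurable borel"
    and J: "J = (\<lambda>y. ennreal p * u y + q y)" and p: "0 < p" "p \<le> 1"
    and q: "(\<integral>\<^sup>+y. q y \<partial>lborel) = ennreal (1 - p)"
    and u: "\<And>j f x. 1 \<le> j \<Longrightarrow> f \<in> borel_measurable borel \<Longrightarrow>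
        (correlate u ^^ j) f x \<le> ennreal (c / (real j + 1)) * (\<integral>\<^sup>+y. f y \<partial>lborel)"
    and M: "\<And>y. J y \<le> ennreal M" and "0 \<le> c" "0 \<le> M"
  shows "\<exists>C>0. \<forall>k\<ge>1. \<forall>f\<in>borel_measurable borel. \<forall>x.
    (correlate J ^^ k) f x \<le> ennreal (C / (real k + 1)) * (\<integral>\<^sup>+y. f y \<partial>lborel)"
proof -
  \<comment> \<open>\<open>c\<close> serves the pure powers of \<open>u\<close>,
    \<open>2 * M\<close> the single factor \<open>J\<close> (where
    \<open>p / 2 + 1 \<le> 2\<close>), and 1 makes \<open>C\<close> positive.\<close>
  define C where "C = c + 2 * M + 1"
  have C: "C > 0" "c \<le> C" "2 * M \<le> C" using assms by (auto simp: C_def)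
  have [measurable]: "J \<in> borel_measurable borel" unfolding J by measurable
  have JM: "correlate J f x \<le> ennreal M * (\<integral>\<^sup>+y. f y \<partial>lborel)" if [measurable]: "f \<in> borel_measurable borel" for f x
    by (rule correlate_le_const) (use M in auto)
  have Jsplit: "correlate J f = (\<lambda>x. ennreal p * correlate u f x + correlate q f x)"
    if [measurable]: "f \<in> borel_measurable borel" for f
    by (intro ext) (simp add: J correlate_add_left correlate_cmult_left)
  \<comment> \<open>Mixed powers make the induction go through: a factor \<open>u\<close> adds 1 to
    the denominator, a factor \<open>J\<close> only \<open>p / 2\<close>.\<close>
  have main: "(correlate J ^^ k) ((correlate u ^^ j) f) x \<le> ennreal (C / (p / 2 * k + j + 1)) * (\<integral>\<^sup>+y. f y \<partial>lborel)"
    if "1 \<le> k + j" "f \<in> borel_measurable borel" for k j f x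
    using that
  proof (induction k arbitrary: j f x)
    case 0
    have "(correlate u ^^ j) f x \<le> ennreal (c / (real j + 1)) * (\<integral>\<^sup>+y. f y \<partial>lborel)"
      using 0 by (intro u) auto
    also have "\<dots> \<le> ennreal (C / (real j + 1)) * (\<integral>\<^sup>+y. f y \<partial>lborel)"
      using C by (intro mult_right_mono ennreal_leI divide_right_mono) auto
    finally show ?case by simp
  next
    case (Suc k)
    note [measurable] = \<open>f \<in> borel_measurable borel\<close>
    define y where "y = p / 2 * k + j + 1"
    have y: "y \<ge> 1" using p by (simp add: y_def)
    show ?case
    proof (cases "k + j = 0")
      \<comment> \<open>The induction hypothesis does not cover \<open>k = j = 0\<close>; the sup
        bound of \<open>J\<close> replaces it.\<close>
      case True
      have "M \<le> C / (p / 2 + 1)"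
      proof -
        have "M * (p / 2 + 1) \<le> M * 2" using p assms by (intro mult_left_mono) auto
        then show ?thesis using C p by (simp add: field_simps)
      qed
      then have "ennreal M * (\<integral>\<^sup>+y. f y \<partial>lborel) \<le> ennreal (C / (p / 2 + 1)) * (\<integral>\<^sup>+y. f y \<partial>lborel)"
        by (intro mult_right_mono ennreal_leI) auto
      then show ?thesis using True JM[of f x] by (auto intro: order_trans)
    next
      case False
      \<comment> \<open>With \<open>1 / (y + p / 2) = 1 / y - (p / 2) / (y * (y + p / 2))\<close>
        this reduces to \<open>y + 1 \<le> 2 * y + p\<close>, true because
        \<open>y \<ge> 1\<close>.\<close>
      have *: "p * (C / (y + 1)) + C / y * (1 - p) \<le> C / (y + p / 2)"
      proof -
        have "p * (1 / (y + 1)) + 1 / y * (1 - p) = 1 / y - p / (y * (y + 1))"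
          using y by (simp add: divide_simps) (simp add: algebra_simps)
        also have "\<dots> \<le> 1 / y - (p / 2) / (y * (y + p / 2))"
        proof -
          have "(p * y / 2) * (y + 1) \<le> (p * y / 2) * (2 * y + p)"
            using y p by (intro mult_left_mono) auto
          then have "(p / 2) * (y * (y + 1)) \<le> p * (y * (y + p / 2))"
            by (simp add: algebra_simps)
          moreover have "a / b \<le> c / d" if "a * d \<le> c * b" "b > 0" "d > 0" for a b c d :: real
            using that by (simp add: field_simps)
          ultimately have "(p / 2) / (y * (y + p / 2)) \<le> p / (y * (y + 1))"
            using y p by simp
          then show ?thesis by simp
        qed
        also have "\<dots> = 1 / (y + p / 2)"
          using y p by (simp add: divide_simps)
        finally have "C * (p * (1 / (y + 1)) + 1 / y * (1 - p)) \<le> C * (1 / (y + p / 2))"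
          using C by (intro mult_left_mono) auto
        then show ?thesis by (simp add: algebra_simps)
      qed
      have "(correlate J ^^ Suc k) ((correlate u ^^ j) f) x = (correlate J ^^ k) (correlate J ((correlate u ^^ j) f)) x"
        by (simp add: funpow_swap1)
      \<comment> \<open>\<open>q\<close> commutes past the powers of \<open>u\<close> onto
        \<open>f\<close>, where it only costs the factor \<open>1 - p\<close> in the
        integral.\<close>
      also have "\<dots> = ennreal p * (correlate J ^^ k) ((correlate u ^^ Suc j) f) x
          + (correlate J ^^ k) ((correlate u ^^ j) (correlate q f)) x"
      proof -
        have "correlate J ((correlate u ^^ j) f) = (\<lambda>x. ennreal p * (correlate u ^^ Suc j) f x + (correlate u ^^ j) (correlate q f) x)"
          by (subst Jsplit) (auto simp: correlate_funpow_commute[of q u f])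
        then show ?thesis by (simp only:) (simp add: correlate_funpow_add)
      qed
      also have "\<dots> \<le> ennreal p * (ennreal (C / (y + 1)) * (\<integral>\<^sup>+y. f y \<partial>lborel))
          + ennreal (C / y) * (\<integral>\<^sup>+y. correlate q f y \<partial>lborel)"
        using Suc.IH[of "Suc j" f x] Suc.IH[of j "correlate q f" x] False
        by (intro add_mono mult_left_mono) (auto simp: y_def algebra_simps)
      also have "\<dots> = ennreal (p * (C / (y + 1)) + C / y * (1 - p)) * (\<integral>\<^sup>+y. f y \<partial>lborel)"
      proof -
        have "ennreal (p * (C / (y + 1)) + C / y * (1 - p)) = ennreal p * ennreal (C / (y + 1)) + ennreal (C / y) * ennreal (1 - p)"
          using p C y by (simp add: ennreal_mult[symmetric] ennreal_plus[symmetric] del: ennreal_plus)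
        then show ?thesis
          by (simp only: nn_integral_correlate[OF \<open>q \<in> borel_measurable borel\<close> \<open>f \<in> borel_measurable borel\<close>] q distrib_right mult.assoc)
      qed
      also have "\<dots> \<le> ennreal (C / (y + p / 2)) * (\<integral>\<^sup>+y. f y \<partial>lborel)"
        using * by (intro mult_right_mono ennreal_leI) auto
      also have "y + p / 2 = p / 2 * Suc k + j + 1"
        by (simp add: y_def algebra_simps)
      finally show ?thesis .
    qed
  qed
  show ?thesis
  proof (intro exI[of _ "2 * C / p"] conjI allI impI ballI)
    fix k :: nat and f :: "'a \<Rightarrow> ennreal" and x
    assume k: "1 \<le> k" and f: "f \<in> borel_measurable borel"
    have "(correlate J ^^ k) f x \<le> ennreal (C / (p / 2 * k + 1)) * (\<integral>\<^sup>+y. f y \<partial>lborel)"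
      using main[of k 0 f x] k f by simp
    also have "C / (p / 2 * k + 1) \<le> C / (p / 2 * (k + 1))"
      using C p by (intro divide_left_mono) (auto simp: algebra_simps add_pos_nonneg)
    also have "\<dots> = 2 * C / p / (real k + 1)"
      using p by (simp add: field_simps)
    finally show "(correlate J ^^ k) f x \<le> ennreal (2 * C / p / (real k + 1)) * (\<integral>\<^sup>+y. f y \<partial>lborel)"
      by (simp add: ennreal_leI mult_right_mono)
  qed (use C p in auto)
qed

section \<open>Averaging over squares\<close>

text \<open>The quotient of consecutive terms is \<open>(2 * n + 1) / (2 * n + 2)\<close>. For the
  squares the bound is inductive because
  \<open>(2 * n + 1) * (2 * n + 3) \<le> (2 * n + 2)\<^sup>2\<close>.\<close>

lemma central_binomial_square_bound:
  "(real ((2 * n) choose n) / 4 ^ n)\<^sup>2 \<le> 1 / (2 * real n + 1)"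
proof (induction n)
  case (Suc n)
  have step: "(real n + 1) * real ((2 * Suc n) choose (Suc n)) = 2 * (2 * real n + 1) * real ((2 * n) choose n)"
  proof -
    have "Suc n * ((2 * Suc n) choose (Suc n)) = (2 * Suc n) * ((2 * n + 1) choose n)"
      using Suc_times_binomial_eq[of "2 * n + 1" n] by (simp add: mult.commute)
    moreover have "Suc n * ((2 * n + 1) choose (Suc n)) = (2 * n + 1) * ((2 * n) choose n)"
      using Suc_times_binomial_eq[of "2 * n" n] by (simp add: mult.commute)
    moreover have "(2 * n + 1) choose (Suc n) = (2 * n + 1) choose n"
      using binomial_symmetric[of "Suc n" "2 * n + 1"] by simp
    ultimately have "Suc n * ((2 * Suc n) choose (Suc n)) = 2 * ((2 * n + 1) * ((2 * n) choose n))"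
      by (metis mult.assoc mult.left_commute)
    then have "real (Suc n) * real ((2 * Suc n) choose (Suc n)) = 2 * (real (2 * n + 1) * real ((2 * n) choose n))"
      by (metis of_nat_mult of_nat_numeral)
    moreover have "real (Suc n) = real n + 1" "real (2 * n + 1) = 2 * real n + 1" by simp_all
    ultimately show ?thesis by (simp only: mult.assoc)
  qed
  define b where "b = real ((2 * n) choose n) / 4 ^ n"
  have "real ((2 * Suc n) choose (Suc n)) / 4 ^ Suc n = b * ((2 * real n + 1) / (2 * real n + 2))"
  proof -
    define c where "c = real ((2 * Suc n) choose (Suc n))"
    have "c * (2 * real n + 2) = real ((2 * n) choose n) * (2 * real n + 1) * 4"
      using step unfolding c_def[symmetric] by (simp add: algebra_simps)
    then show ?thesis
      unfolding c_def[symmetric] b_def by (simp add: divide_simps)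
  qed
  then have "(real ((2 * Suc n) choose (Suc n)) / 4 ^ Suc n)\<^sup>2 = b\<^sup>2 * ((2 * real n + 1) / (2 * real n + 2))\<^sup>2"
    by (simp only: power_mult_distrib)
  also have "\<dots> \<le> 1 / (2 * real n + 1) * ((2 * real n + 1) / (2 * real n + 2))\<^sup>2"
    using Suc by (intro mult_right_mono) (auto simp: b_def)
  also have "\<dots> = (2 * real n + 1) / (2 * real n + 2)\<^sup>2"
    by (simp add: power2_eq_square)
  also have "\<dots> \<le> 1 / (2 * real (Suc n) + 1)"
    by (simp add: divide_simps) (simp add: power2_eq_square algebra_simps)
  finally show ?case .
qed simp

text \<open>The largest coefficient of a row is the central one; an odd row is compared with the
  even row before it by Pascal's rule.\<close>

lemma binomial_weight_square_bound:
  "(real (m choose i) / 2 ^ m)\<^sup>2 \<le> 2 / (real m + 1)"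
proof -
  define n where "n = m div 2"
  have "real (m choose i) / 2 ^ m \<le> real (m choose n) / 2 ^ m"
    using binomial_maximum[of m i] by (intro divide_right_mono) (auto simp: n_def)
  also have "\<dots> \<le> real ((2 * n) choose n) / 4 ^ n"
  proof (cases "even m")
    case True
    then have "m = 2 * n" by (simp add: n_def)
    then show ?thesis by (simp add: power_mult)
  next
    case False
    then have m: "m = Suc (2 * n)" by (simp add: n_def)
    have "m choose n \<le> 2 * ((2 * n) choose n)"
    proof (cases n)
      case (Suc l)
      then show ?thesis using binomial_maximum'[of n l] unfolding m by simp
    qed (simp add: m)
    then have "real (m choose n) \<le> 2 * real ((2 * n) choose n)"
      by (metis of_nat_le_iff of_nat_mult of_nat_numeral)
    moreover have "(2::real) ^ m = 2 * 4 ^ n" by (simp add: m power_mult)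
    ultimately show ?thesis by (simp add: divide_simps)
  qed
  finally have "(real (m choose i) / 2 ^ m)\<^sup>2 \<le> (real ((2 * n) choose n) / 4 ^ n)\<^sup>2"
    by (intro power_mono) auto
  also have "\<dots> \<le> 1 / (2 * real n + 1)"
    by (rule central_binomial_square_bound)
  also have "\<dots> \<le> 2 / (real m + 1)"
  proof -
    have "m \<le> 2 * n + 1" by (simp add: n_def)
    then have "real m \<le> 2 * real n + 1" by linarith
    then show ?thesis by (simp add: field_simps)
  qed
  finally show ?thesis .
qed

section \<open>Lazy walk in one direction\<close>

lemma ennreal_half_double: "ennreal (1/2) * (x + x) = x"
proof -
  have "ennreal (1/2) + ennreal (1/2) = 1"
    by (subst ennreal_plus[symmetric]) auto
  moreover have "ennreal (1/2) * (x + x) = (ennreal (1/2) + ennreal (1/2)) * x"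
    by (simp only: distrib_left distrib_right)
  ultimately show ?thesis by simp
qed

text \<open>Transition operator of the walk that stays or jumps by \<open>z\<close>, each with
  probability 1/2; its powers carry binomial weights.\<close>

definition half_step :: "'a::euclidean_space \<Rightarrow> ('a \<Rightarrow> ennreal) \<Rightarrow> 'a \<Rightarrow> ennreal" where
  "half_step z f x = ennreal (1/2) * (f x + f (x + z))"

lemma measurable_half_step [measurable]:
  assumes [measurable]: "f \<in> borel_measurable borel"
  shows "half_step z f \<in> borel_measurable borel"
  unfolding half_step_def by measurable

lemma measurable_half_step_funpow [measurable]:
  assumes [measurable]: "f \<in> borel_measurable borel"
  shows "(half_step z ^^ n) f \<in> borel_measurable borel"
  by (induction n) auto

lemma half_step_commute: "half_step z (half_step w f) = half_step w (half_step z f)"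
  by (intro ext) (simp add: half_step_def ac_simps distrib_left)

lemma half_step_funpow_commute: "half_step z ((half_step w ^^ n) f) = (half_step w ^^ n) (half_step z f)"
  by (induction n) (auto simp: half_step_commute)

lemma correlate_half_step:
  assumes [measurable]: "k \<in> borel_measurable borel" "f \<in> borel_measurable borel"
  shows "correlate k (half_step z f) = half_step z (correlate k f)"
proof
  fix x
  have "correlate k (half_step z f) x = ennreal (1/2) * (correlate k f x + correlate k (\<lambda>y. f (y + z)) x)"
  proof -
    have "half_step z f = (\<lambda>x. ennreal (1/2) * (f x + f (x + z)))" by (auto simp: half_step_def)
    then show ?thesis by (simp only:) (subst correlate_cmult, simp_all add: correlate_add)
  qed
  also have "correlate k (\<lambda>y. f (y + z)) x = correlate k f (x + z)"
    by (simp add: correlate_def add.assoc add.commute[of z])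
  finally show "correlate k (half_step z f) x = half_step z (correlate k f) x"
    unfolding half_step_def[of z "correlate k f"] .
qed

lemma correlate_half_step_funpow:
  assumes [measurable]: "k \<in> borel_measurable borel" "f \<in> borel_measurable borel"
  shows "correlate k ((half_step z ^^ n) f) = (half_step z ^^ n) (correlate k f)"
  by (induction n) (auto simp: correlate_half_step)

text \<open>Binomial expansion with the largest weight pulled out: what remains is an unweighted sum
  over translates, which disjointness can bound.\<close>

lemma half_step_funpow_le:
  assumes "\<And>i. i \<le> n \<Longrightarrow> real (n choose i) / 2 ^ n \<le> W"
  shows "(half_step z ^^ n) f x \<le> ennreal W * (\<Sum>i\<le>n. f (x + real i *\<^sub>R z))"
proof -
  have "(half_step z ^^ n) f x = ennreal (1 / 2 ^ n) * (\<Sum>i\<le>n. of_nat (n choose i) * f (x + real i *\<^sub>R z))" for n x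
  proof (induction n arbitrary: x)
    case (Suc n)
    let ?g = "\<lambda>i. f (x + real i *\<^sub>R z)"
    have shift: "x + z + real i *\<^sub>R z = x + real (Suc i) *\<^sub>R z" for i
      by (simp add: algebra_simps)
    have "(half_step z ^^ Suc n) f x = ennreal (1/2) * (ennreal (1 / 2 ^ n) *
        ((\<Sum>i\<le>n. of_nat (n choose i) * ?g i) + (\<Sum>i\<le>n. of_nat (n choose i) * ?g (Suc i))))"
      by (simp only: funpow.simps o_def half_step_def Suc shift distrib_left)
    also have "\<dots> = ennreal (1 / 2 ^ Suc n) *
        ((\<Sum>i\<le>n. of_nat (n choose i) * ?g i) + (\<Sum>i\<le>n. of_nat (n choose i) * ?g (Suc i)))"
    proof -
      have "ennreal (1/2) * ennreal (1 / 2 ^ n) = ennreal (1 / 2 ^ Suc n)"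
        by (subst ennreal_mult[symmetric]) auto
      then show ?thesis by (simp only: mult.assoc[symmetric])
    qed
    \<comment> \<open>Pascal's rule, after an index shift in the second sum.\<close>
    also have "(\<Sum>i\<le>n. of_nat (n choose i) * ?g i) + (\<Sum>i\<le>n. of_nat (n choose i) * ?g (Suc i))
       = (\<Sum>i\<le>Suc n. of_nat (Suc n choose i) * ?g i)"
    proof -
      have "(\<Sum>i\<le>Suc n. of_nat (Suc n choose i) * ?g i)
         = ?g 0 + (\<Sum>i\<le>n. of_nat (Suc n choose Suc i) * ?g (Suc i))"
        by (subst sum.atMost_Suc_shift) simp
      also have "\<dots> = ?g 0 + (\<Sum>i\<le>n. of_nat (n choose Suc i) * ?g (Suc i)) + (\<Sum>i\<le>n. of_nat (n choose i) * ?g (Suc i))"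
        by (simp only: binomial_Suc_Suc of_nat_add distrib_right sum.distrib) (simp only: ac_simps)
      also have "?g 0 + (\<Sum>i\<le>n. of_nat (n choose Suc i) * ?g (Suc i)) = (\<Sum>i\<le>Suc n. of_nat (n choose i) * ?g i)"
        by (subst sum.atMost_Suc_shift) simp
      also have "\<dots> = (\<Sum>i\<le>n. of_nat (n choose i) * ?g i)" by simp
      finally show ?thesis by simp
    qed
    finally show ?case .
  qed simp
  then have "(half_step z ^^ n) f x = (\<Sum>i\<le>n. ennreal (real (n choose i) / 2 ^ n) * f (x + real i *\<^sub>R z))"
    by (simp add: sum_distrib_left mult.assoc[symmetric] ennreal_of_nat_eq_real_of_nat ennreal_mult[symmetric])
  also have "\<dots> \<le> (\<Sum>i\<le>n. ennreal W * f (x + real i *\<^sub>R z))"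
    using assms by (intro sum_mono mult_right_mono ennreal_leI) auto
  finally show ?thesis by (simp add: sum_distrib_left)
qed

text \<open>The half-open intervals \<open>{i * a..<i * a + a}\<close> are disjoint, so at most one
  summand is 1.\<close>

lemma sum_indicator_translates_le_1:
  fixes a t :: real
  assumes "a > 0"
  shows "(\<Sum>i\<le>n. indicator {0..<a} (t - real i * a) :: ennreal) \<le> 1"
proof -
  have "i = j" if "0 \<le> t - real i * a" "t - real i * a < a" "0 \<le> t - real j * a" "t - real j * a < a" for i j :: nat
  proof -
    have "(real i - real j) * a < 1 * a" "(real j - real i) * a < 1 * a" using that by (auto simp: algebra_simps)
    then have "real i - real j < 1" "real j - real i < 1" using assms by (auto simp only: mult_less_cancel_right)
    then show ?thesis by linarith
  qed
  then have "card {i \<in> {..n}. t - real i * a \<in> {0..<a}} \<le> Suc 0"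
    by (intro iffD2[OF card_le_Suc0_iff_eq]) auto
  moreover have "(\<Sum>i\<le>n. indicator {0..<a} (t - real i * a) :: ennreal) = of_nat (card {i \<in> {..n}. t - real i * a \<in> {0..<a}})"
  proof -
    have "(\<Sum>i\<le>n. indicator {0..<a} (t - real i * a) :: ennreal) = (\<Sum>i\<in>{i \<in> {..n}. t - real i * a \<in> {0..<a}}. 1)"
      by (rule sum.mono_neutral_cong_right) (auto simp: indicator_def)
    then show ?thesis by simp
  qed
  ultimately show ?thesis
    using of_nat_mono[of "card {i \<in> {..n}. t - real i * a \<in> {0..<a}}" "Suc 0", where 'a = ennreal] by simp
qed

section \<open>Uniform densities on squares\<close>

definition square_kernel :: "real \<Rightarrow> real ^ 2 \<Rightarrow> ennreal" where
  "square_kernel a y = ennreal (1 / a\<^sup>2) * (indicator {0..<a} (y $ 1) * indicator {0..<a} (y $ 2))"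

lemma measurable_square_kernel [measurable]: "square_kernel a \<in> borel_measurable borel"
  unfolding square_kernel_def by measurable

text \<open>Translating \<open>f\<close> amounts to translating the kernel, and the translated
  squares are disjoint, so the summed kernel is still at most \<open>1 / a\<^sup>2\<close>.\<close>

lemma sum_correlate_square_kernel_le:
  assumes a: "a > 0" and [measurable]: "f \<in> borel_measurable borel"
  shows "(\<Sum>i\<le>n. \<Sum>l\<le>n. correlate (square_kernel a) f (x + real i *\<^sub>R axis 1 a + real l *\<^sub>R axis 2 a))
    \<le> ennreal (1 / a\<^sup>2) * (\<integral>\<^sup>+y. f y \<partial>lborel)"
proof -
  let ?z = "\<lambda>i l. real i *\<^sub>R axis 1 a + real l *\<^sub>R axis 2 a :: real ^ 2"
  have "(\<Sum>i\<le>n. \<Sum>l\<le>n. correlate (square_kernel a) f (x + ?z i l))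
     = (\<Sum>i\<le>n. \<Sum>l\<le>n. correlate (\<lambda>y. square_kernel a (y - ?z i l)) f x)"
    by (simp add: correlate_shift)
  also have "\<dots> = (\<integral>\<^sup>+y. (\<Sum>i\<le>n. \<Sum>l\<le>n. square_kernel a (y - ?z i l)) * f (x + y) \<partial>lborel)"
    unfolding correlate_def sum_distrib_right by (subst nn_integral_sum, measurable)+
  also have "\<dots> = correlate (\<lambda>y. \<Sum>i\<le>n. \<Sum>l\<le>n. square_kernel a (y - ?z i l)) f x"
    unfolding correlate_def ..
  also have "\<dots> \<le> ennreal (1 / a\<^sup>2) * (\<integral>\<^sup>+y. f y \<partial>lborel)"
  proof (rule correlate_le_const)
    fix y :: "real ^ 2"
    have "square_kernel a (y - ?z i l) = ennreal (1 / a\<^sup>2) *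
        (indicator {0..<a} (y $ 1 - real i * a) * indicator {0..<a} (y $ 2 - real l * a))" for i l
      by (simp add: square_kernel_def axis_def)
    note * = this
    have "(\<Sum>i\<le>n. \<Sum>l\<le>n. square_kernel a (y - ?z i l)) = ennreal (1 / a\<^sup>2) *
        ((\<Sum>i\<le>n. indicator {0..<a} (y $ 1 - real i * a)) * (\<Sum>l\<le>n. indicator {0..<a} (y $ 2 - real l * a)))"
      unfolding * sum_product by (simp only: sum_distrib_left)
    also have "\<dots> \<le> ennreal (1 / a\<^sup>2) * (1 * 1)"
      using a by (intro mult_left_mono mult_mono sum_indicator_translates_le_1) auto
    finally show "(\<Sum>i\<le>n. \<Sum>l\<le>n. square_kernel a (y - ?z i l)) \<le> ennreal (1 / a\<^sup>2)" by simp
  qed auto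
  finally show ?thesis by (simp add: add.assoc)
qed

lemma nn_integral_square_kernel: 
  assumes a: "a > 0"
  shows "(\<integral>\<^sup>+y. square_kernel a y \<partial>lborel) = 1"
proof -
  define S where "S = {y :: real ^ 2. 0 \<le> y $ 1 \<and> y $ 1 < a \<and> 0 \<le> y $ 2 \<and> y $ 2 < a}"
  have S: "S \<in> sets borel" unfolding S_def by measurable
  \<comment> \<open>The half-open square lies between the open and the closed box, which have the
    same measure.\<close>
  have sub: "box 0 (vec a) \<subseteq> S" "S \<subseteq> cbox 0 (vec a)"
    by (auto simp: S_def mem_box_cart forall_2 less_imp_le)
  have e: "emeasure lborel (cbox 0 (vec a :: real ^ 2)) = ennreal (a\<^sup>2)" 
      "emeasure lborel (box 0 (vec a :: real ^ 2)) = ennreal (a\<^sup>2)"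
  proof -
    have "(\<Prod>b\<in>Basis. (vec a - 0 :: real ^ 2) \<bullet> b) = a\<^sup>2"
      using a by (simp add: Basis_vec_def prod.UNION_disjoint inner_axis axis_eq_axis UNIV_2 power2_eq_square)
    moreover have "(0::real^2) \<bullet> b \<le> vec a \<bullet> b" if "b \<in> Basis" for b
      using that a by (auto simp: Basis_vec_def inner_axis)
    ultimately show "emeasure lborel (cbox 0 (vec a :: real ^ 2)) = ennreal (a\<^sup>2)" 
      "emeasure lborel (box 0 (vec a :: real ^ 2)) = ennreal (a\<^sup>2)"
      by (simp_all add: emeasure_lborel_cbox emeasure_lborel_box)
  qed
  have "emeasure lborel S = ennreal (a\<^sup>2)"
    using emeasure_mono[OF sub(1), of lborel] emeasure_mono[OF sub(2), of lborel] S e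
    by (auto intro!: antisym)
  moreover have "square_kernel a = (\<lambda>y. ennreal (1 / a\<^sup>2) * indicator S y)"
    by (intro ext) (auto simp: square_kernel_def S_def indicator_def)
  ultimately show ?thesis
    using a S by (simp add: nn_integral_cmult ennreal_mult[symmetric])
qed

text \<open>The square \<open>[0, 2a)\<^sup>2\<close> is the union of four translates of \<open>[0, a)\<^sup>2\<close>, so averaging over it
  is one step of a lazy walk on the lattice \<open>a \<int>\<^sup>2\<close> followed by averaging over \<open>[0, a)\<^sup>2\<close>. The
  translates of the latter by lattice vectors are disjoint, so the decay comes from the binomial
  weights of the walk.\<close>

definition double_square_kernel :: "real \<Rightarrow> real ^ 2 \<Rightarrow> ennreal" where
  "double_square_kernel a y = ennreal (1/2) * (ennreal (1/2) * (square_kernel a y + square_kernel a (y - axis 1 a))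
     + ennreal (1/2) * (square_kernel a (y - axis 2 a) + square_kernel a (y - axis 2 a - axis 1 a)))"

lemma measurable_double_square_kernel [measurable]: "double_square_kernel a \<in> borel_measurable borel"
  unfolding double_square_kernel_def[abs_def] by measurable

lemma correlate_double_square_kernel:
  assumes [measurable]: "f \<in> borel_measurable borel"
  shows "correlate (double_square_kernel a) f = half_step (axis 2 a) (half_step (axis 1 a) (correlate (square_kernel a) f))"
proof
  fix x
  have "correlate (double_square_kernel a) f x =
     ennreal (1/2) * (ennreal (1/2) * (correlate (square_kernel a) f x + correlate (\<lambda>y. square_kernel a (y - axis 1 a)) f x)
     + ennreal (1/2) * (correlate (\<lambda>y. square_kernel a (y - axis 2 a)) f x
         + correlate (\<lambda>y. square_kernel a (y - (axis 2 a + axis 1 a))) f x))"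
    unfolding double_square_kernel_def[abs_def] diff_diff_eq
    by (simp add: correlate_cmult_left correlate_add_left)
  then show "correlate (double_square_kernel a) f x = half_step (axis 2 a) (half_step (axis 1 a) (correlate (square_kernel a) f)) x"
    by (simp only: correlate_shift[OF measurable_square_kernel assms] half_step_def add.assoc)
qed

text \<open>All three operators commute, so their powers can be collected.\<close>

lemma correlate_double_square_kernel_funpow:
  assumes [measurable]: "f \<in> borel_measurable borel"
  shows "(correlate (double_square_kernel a) ^^ n) f =
    (half_step (axis 2 a) ^^ n) ((half_step (axis 1 a) ^^ n) ((correlate (square_kernel a) ^^ n) f))"
proof (induction n)
  case (Suc n)
  let ?V = "correlate (square_kernel a)" and ?H1 = "half_step (axis 1 a :: real ^ 2)" and ?H2 = "half_step (axis 2 a :: real ^ 2)"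
  have "(correlate (double_square_kernel a) ^^ Suc n) f = ?H2 (?H1 (?V ((?H2 ^^ n) ((?H1 ^^ n) ((?V ^^ n) f)))))"
    by (simp add: Suc correlate_double_square_kernel)
  also have "?V ((?H2 ^^ n) ((?H1 ^^ n) ((?V ^^ n) f))) = (?H2 ^^ n) ((?H1 ^^ n) (?V ((?V ^^ n) f)))"
    by (simp add: correlate_half_step_funpow)
  finally show ?case
    by (simp add: half_step_funpow_commute)
qed simp

text \<open>Each of the two lattice directions contributes a weight of order
  \<open>1 / sqrt n\<close>, which is where the dimension enters. One factor
  \<open>square_kernel\<close> is spent on the disjoint translates; the remaining ones preserve the
  integral.\<close>

lemma double_square_kernel_funpow_bound:
  assumes a: "a > 0" and [measurable]: "f \<in> borel_measurable borel" and n: "1 \<le> n"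
  shows "(correlate (double_square_kernel a) ^^ n) f x \<le> ennreal (2 / a\<^sup>2 / (real n + 1)) * (\<integral>\<^sup>+y. f y \<partial>lborel)"
proof -
  obtain m where m: "n = Suc m" using n by (cases n) auto
  let ?V = "correlate (square_kernel a)" and ?H1 = "half_step (axis 1 a :: real ^ 2)" and ?H2 = "half_step (axis 2 a :: real ^ 2)"
  define W where "W = sqrt (2 / (real n + 1))"
  have W: "real (n choose i) / 2 ^ n \<le> W" for i
    using binomial_weight_square_bound[of n i] by (auto simp: W_def intro: real_le_rsqrt)
  have "(correlate (double_square_kernel a) ^^ n) f x = (?H2 ^^ n) ((?H1 ^^ n) ((?V ^^ n) f)) x"
    by (simp only: correlate_double_square_kernel_funpow[OF assms(2)])
  also have "\<dots> \<le> ennreal W * (\<Sum>l\<le>n. (?H1 ^^ n) ((?V ^^ n) f) (x + real l *\<^sub>R axis 2 a))"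
    by (rule half_step_funpow_le) (rule W)
  also have "\<dots> \<le> ennreal W * (\<Sum>l\<le>n. ennreal W * (\<Sum>i\<le>n. (?V ^^ n) f (x + real l *\<^sub>R axis 2 a + real i *\<^sub>R axis 1 a)))"
    by (intro mult_left_mono sum_mono half_step_funpow_le W) auto
  also have "\<dots> = ennreal W * ennreal W * (\<Sum>l\<le>n. \<Sum>i\<le>n. ?V ((?V ^^ m) f) (x + real l *\<^sub>R axis 2 a + real i *\<^sub>R axis 1 a))"
  proof -
    have "(?V ^^ n) f = ?V ((?V ^^ m) f)" by (simp add: m)
    then show ?thesis by (simp only: sum_distrib_left mult.assoc)
  qed
  also have "ennreal W * ennreal W = ennreal (2 / (real n + 1))"
    by (simp add: W_def ennreal_mult[symmetric])
  also have "(\<Sum>l\<le>n. \<Sum>i\<le>n. ?V ((?V ^^ m) f) (x + real l *\<^sub>R axis 2 a + real i *\<^sub>R axis 1 a))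
     = (\<Sum>i\<le>n. \<Sum>l\<le>n. ?V ((?V ^^ m) f) (x + real i *\<^sub>R axis 1 a + real l *\<^sub>R axis 2 a))"
    by (subst sum.swap) (simp add: ac_simps)
  also have "\<dots> \<le> ennreal (1 / a\<^sup>2) * (\<integral>\<^sup>+y. (?V ^^ m) f y \<partial>lborel)"
    by (rule sum_correlate_square_kernel_le[OF a]) simp
  also have "(\<integral>\<^sup>+y. (?V ^^ m) f y \<partial>lborel) = (\<integral>\<^sup>+y. f y \<partial>lborel)"
    by (induction m) (simp_all add: nn_integral_correlate nn_integral_square_kernel a)
  finally have "(correlate (double_square_kernel a) ^^ n) f x
      \<le> ennreal (2 / (real n + 1)) * (ennreal (1 / a\<^sup>2) * (\<integral>\<^sup>+y. f y \<partial>lborel))"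
    by (simp add: mult_left_mono)
  also have "\<dots> = ennreal (2 / a\<^sup>2 / (real n + 1)) * (\<integral>\<^sup>+y. f y \<partial>lborel)"
  proof -
    have "ennreal (2 / (real n + 1)) * ennreal (1 / a\<^sup>2) = ennreal (2 / a\<^sup>2 / (real n + 1))"
      by (subst ennreal_mult[symmetric]) (auto simp: mult.commute)
    then show ?thesis by (simp only: mult.assoc[symmetric])
  qed
  finally show ?thesis .
qed

lemma square_kernel_le: "square_kernel a y \<le> ennreal (1 / a\<^sup>2)"
  by (auto simp: square_kernel_def indicator_def)

lemma double_square_kernel_le: "double_square_kernel a y \<le> ennreal (1 / a\<^sup>2)"
proof -
  have "double_square_kernel a y \<le> ennreal (1/2) * (ennreal (1/2) * (ennreal (1 / a\<^sup>2) + ennreal (1 / a\<^sup>2))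
     + ennreal (1/2) * (ennreal (1 / a\<^sup>2) + ennreal (1 / a\<^sup>2)))"
    unfolding double_square_kernel_def by (intro mult_left_mono add_mono square_kernel_le) auto
  also have "\<dots> = ennreal (1 / a\<^sup>2)"
    by (simp only: ennreal_half_double)
  finally show ?thesis .
qed

lemma nn_integral_double_square_kernel:
  assumes "a > 0"
  shows "(\<integral>\<^sup>+y. double_square_kernel a y \<partial>lborel) = 1"
proof -
  have *: "(\<integral>\<^sup>+y. square_kernel a (y - z) \<partial>lborel) = 1" for z
    using nn_integral_lborel_shift[of "square_kernel a" "- z"] nn_integral_square_kernel[OF assms] by simp
  have "(\<integral>\<^sup>+y. double_square_kernel a y \<partial>lborel) = ennreal (1/2) * (ennreal (1/2) * (1 + 1) + ennreal (1/2) * (1 + 1))"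
    unfolding double_square_kernel_def diff_diff_eq
    by (simp add: nn_integral_cmult nn_integral_add * nn_integral_square_kernel[OF assms])
  also have "\<dots> = 1"
    by (simp only: ennreal_half_double)
  finally show ?thesis .
qed

text \<open>On the support each coordinate is below \<open>2 * a\<close>, so the l1 norm, which
  dominates the euclidean one, is below \<open>4 * a\<close>.\<close>

lemma double_square_kernel_eq_0:
  assumes a: "a > 0" and y: "norm y \<ge> 4 * a"
  shows "double_square_kernel a y = 0"
proof (rule ccontr)
  assume "double_square_kernel a y \<noteq> 0"
  then have "\<bar>y $ 1\<bar> < 2 * a \<and> \<bar>y $ 2\<bar> < 2 * a"
    using a by (auto simp: double_square_kernel_def square_kernel_def indicator_def axis_def split: if_splits)
  moreover have "norm y \<le> \<bar>y $ 1\<bar> + \<bar>y $ 2\<bar>"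
    using norm_le_l1_cart[of y] by (simp add: sum_2)
  ultimately show False using y by linarith
qed

section \<open>Poisson mixtures and powers of a bump kernel\<close>

text \<open>For positive \<open>n\<close>, the function \<open>f n r\<close> below interpolates
  between the partial sum at \<open>r = s\<close> and the limit at \<open>r = t\<close>. Its
  derivative telescopes to one term, which is small because of the factorial.\<close>

lemma poisson_series:
  fixes m :: "nat \<Rightarrow> real \<Rightarrow> real"
  assumes "s \<le> t"
    and cont: "\<And>k. continuous_on {s..t} (m k)"
    and deriv: "\<And>k r. s < r \<Longrightarrow> r < t \<Longrightarrow> (m k has_real_derivative (m (Suc k) r - m k r)) (at r)"
    and bound: "\<And>k r. s \<le> r \<Longrightarrow> r \<le> t \<Longrightarrow> \<bar>m k r\<bar> \<le> C"
  shows "(\<lambda>k. (t - s) ^ k / fact k * m k s) sums (exp (t - s) * m 0 t)"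
proof (cases "s = t")
  case True
  then show ?thesis
    using sums_finite[of "{0}" "\<lambda>k. (t - s) ^ k / fact k * m k s"] by simp
next
  case False
  with assms have st: "s < t" by simp
  define f where "f n r = (\<Sum>k<n. (t - r) ^ k / fact k * (exp (r - s) * m k r))" for n r
  \<comment> \<open>The mean value theorem turns the telescoped derivative into this error.\<close>
  define e where "e n = (t - s) * ((t - s) ^ n / fact n * (exp (t - s) * C))" for n
  have C: "C \<ge> 0" using bound[of s 0] st by linarith
  have f_deriv: "(f (Suc n) has_real_derivative ((t - r) ^ n / fact n * (exp (r - s) * m (Suc n) r))) (at r)"
    if "s < r" "r < t" for n r
  proof (induction n)
    case 0
    show ?case unfolding f_def
      by (auto intro!: derivative_eq_intros deriv that simp: algebra_simps)
  next
    case (Suc n)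
    let ?E = "exp (r - s)"
    have "((\<lambda>r. (t - r) ^ Suc n / fact (Suc n) * (exp (r - s) * m (Suc n) r)) has_real_derivative
        ((- ((t - r) ^ n / fact n)) * (?E * m (Suc n) r)
         + (t - r) ^ Suc n / fact (Suc n) * (?E * m (Suc n) r + ?E * (m (Suc (Suc n)) r - m (Suc n) r)))) (at r)"
    proof -
      have "((\<lambda>r. (t - r) ^ Suc n / fact (Suc n)) has_real_derivative - ((t - r) ^ n / fact n)) (at r)"
      proof (rule DERIV_cong[OF DERIV_cdivide])
        show "((\<lambda>r. (t - r) ^ Suc n) has_real_derivative - (real (Suc n) * (t - r) ^ n)) (at r)"
          by (rule derivative_eq_intros refl)+ simp
        show "- (real (Suc n) * (t - r) ^ n) / fact (Suc n) = - ((t - r) ^ n / fact n)"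
          unfolding fact_Suc by (simp del: of_nat_Suc)
      qed
      moreover have "((\<lambda>r. exp (r - s) * m (Suc n) r) has_real_derivative
         (?E * m (Suc n) r + ?E * (m (Suc (Suc n)) r - m (Suc n) r))) (at r)"
        by (rule derivative_eq_intros deriv that refl)+ simp
      ultimately show ?thesis
        by (rule DERIV_cong[OF DERIV_mult]) (simp only: mult_ac add_ac)
    qed
    from DERIV_add[OF Suc this] show ?case
      unfolding f_def sum.lessThan_Suc[of _ "Suc n"] by (rule DERIV_cong) (simp add: algebra_simps)
  qed
  have f_cont: "continuous_on {s..t} (f n)" for n
    unfolding f_def by (intro continuous_intros cont) auto
  have f_t: "f (Suc n) t = exp (t - s) * m 0 t" for n
    unfolding f_def by (subst sum.lessThan_Suc_shift) simp
  have f_s: "f n s = (\<Sum>k<n. (t - s) ^ k / fact k * m k s)" for n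
    unfolding f_def by simp
  have est: "\<bar>f (Suc n) s - exp (t - s) * m 0 t\<bar> \<le> e n" for n
  proof -
    obtain r where r: "s < r" "r < t"
      "f (Suc n) t - f (Suc n) s = (t - s) * ((t - r) ^ n / fact n * (exp (r - s) * m (Suc n) r))"
    proof -
      obtain l r where r: "s < r" "r < t" "(f (Suc n) has_real_derivative l) (at r)"
        "f (Suc n) t - f (Suc n) s = (t - s) * l"
        using MVT[OF st f_cont, of "Suc n"] f_deriv unfolding real_differentiable_def by blast
      with that[of r] DERIV_unique[OF r(3) f_deriv] show thesis by auto
    qed
    have "\<bar>(t - r) ^ n / fact n * (exp (r - s) * m (Suc n) r)\<bar> \<le> (t - s) ^ n / fact n * (exp (t - s) * C)"
      unfolding abs_mult abs_divide using r bound[of r "Suc n"] C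
      by (intro mult_mono divide_mono) (auto simp: power_abs intro: power_mono)
    then have "\<bar>f (Suc n) t - f (Suc n) s\<bar> \<le> e n"
      unfolding r(3) e_def abs_mult[of "t - s"] using st by (intro mult_mono) auto
    then show ?thesis by (simp add: f_t abs_minus_commute)
  qed
  have "(\<lambda>n. (t - s) ^ n / fact n) \<longlonglongrightarrow> 0"
    using summable_LIMSEQ_zero[OF summable_exp[of "t - s"]] by (simp add: field_simps)
  then have "e \<longlonglongrightarrow> 0"
    unfolding e_def by (intro tendsto_mult_right_zero tendsto_mult_left_zero)
  then have "(\<lambda>n. f (Suc n) s - exp (t - s) * m 0 t) \<longlonglongrightarrow> 0"
    using Lim_null_comparison[of "\<lambda>n. f (Suc n) s - exp (t - s) * m 0 t" e sequentially] est by simp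
  then have "(\<lambda>n. f (Suc n) s) \<longlonglongrightarrow> exp (t - s) * m 0 t"
    by (rule LIM_zero_cancel)
  then have "(\<lambda>n. f n s) \<longlonglongrightarrow> exp (t - s) * m 0 t"
    by (rule filterlim_sequentially_Suc[THEN iffD1])
  then show ?thesis by (simp add: sums_def f_s)
qed

section \<open>Smoothing by powers of a bump kernel\<close>

locale bump_kernel =
  fixes J :: "real ^ 2 \<Rightarrow> real" and d :: real
  assumes J_cont: "continuous_on UNIV J"
    and d_pos: "0 < d"
    and J_pos: "norm x < d \<Longrightarrow> 0 < J x"
    and J_zero: "d \<le> norm x \<Longrightarrow> J x = 0"
    and J_int: "(LINT x|lborel. J x) = 1"
begin

lemma J_nonneg: "0 \<le> J x"
  using J_pos[of x] J_zero[of x] by (cases "norm x < d") auto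

lemma J_measurable [measurable]: "J \<in> borel_measurable borel"
  by (rule borel_measurable_continuous_onI[OF J_cont])

lemma J_integrable [simp]: "integrable lborel J"
  using J_int not_integrable_integral_eq by fastforce

lemma nn_integral_J: "(\<integral>\<^sup>+y. ennreal (J y) \<partial>lborel) = 1"
  by (subst nn_integral_eq_integral) (auto simp: J_nonneg J_int)

lemma J_bounded: obtains M where "0 \<le> M" "\<And>x. J x \<le> M"
proof -
  obtain y where y: "y \<in> cball 0 d" "\<And>x. x \<in> cball 0 d \<Longrightarrow> J x \<le> J y"
    using continuous_attains_sup[OF compact_cball _ continuous_on_subset[OF J_cont], of 0 d] d_pos by auto
  have "J x \<le> J y" for x
    using y(2)[of x] J_zero[of x] J_nonneg[of y] by (cases "norm x \<le> d") auto
  with J_nonneg[of y] show thesis by (rule that)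
qed

lemma J_bounded_below:
  assumes "r < d"
  obtains m where "0 < m" "\<And>x. norm x \<le> r \<Longrightarrow> m \<le> J x"
proof (cases "0 \<le> r")
  case True
  then obtain y where y: "y \<in> cball 0 r" "\<And>x. x \<in> cball 0 r \<Longrightarrow> J y \<le> J x"
    using continuous_attains_inf[OF compact_cball _ continuous_on_subset[OF J_cont], of 0 r] by auto
  show thesis
    using J_pos[of y] y assms by (intro that[of "J y"]) auto
next
  case False
  then show thesis by (intro that[of 1]) (auto dest: order_trans[OF norm_ge_zero])
qed

abbreviation "step \<equiv> correlate (\<lambda>y. ennreal (J y))"

lemma step_funpow_bound:
  obtains C where "0 < C"
    "\<And>k f x. 1 \<le> k \<Longrightarrow> f \<in> borel_measurable borel \<Longrightarrow>
      (step ^^ k) f x \<le> ennreal (C / (real k + 1)) * (\<integral>\<^sup>+y. f y \<partial>lborel)"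
proof -
  obtain M where M: "0 \<le> M" "\<And>x. J x \<le> M" using J_bounded by blast
  obtain m where m: "0 < m" "\<And>x. norm x \<le> d / 2 \<Longrightarrow> m \<le> J x"
    using J_bounded_below[of "d / 2"] d_pos by auto
  \<comment> \<open>Then \<open>double_square_kernel a\<close> lives in the ball of radius
    \<open>4 * a = d / 2\<close>, where \<open>J\<close> is at least \<open>m\<close>.\<close>
  define a where "a = d / 8"
  have a: "a > 0" using d_pos by (simp add: a_def)
  \<comment> \<open>\<open>p \<le> a\<^sup>2 * m\<close> gives \<open>p * ?u \<le> J\<close>, and
    \<open>p \<le> 1\<close> keeps the mass \<open>1 - p\<close> of the remainder
    nonnegative.\<close>
  define p where "p = min 1 (a\<^sup>2 * m)"
  have p: "0 < p" "p \<le> 1" "p / a\<^sup>2 \<le> m" using m a by (auto simp: p_def min_def field_simps)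
  let ?u = "double_square_kernel a"
  define q where "q y = ennreal (J y) - ennreal p * ?u y" for y
  have [measurable]: "q \<in> borel_measurable borel" unfolding q_def[abs_def] by measurable
  have le: "ennreal p * ?u y \<le> ennreal (J y)" for y
  proof (cases "norm y < 4 * a")
    case True
    have "ennreal p * ?u y \<le> ennreal p * ennreal (1 / a\<^sup>2)"
      by (intro mult_left_mono double_square_kernel_le) auto
    also have "\<dots> = ennreal (p / a\<^sup>2)" using p by (subst ennreal_mult[symmetric]) auto
    also have "\<dots> \<le> ennreal (J y)"
      using p m(2)[of y] True by (intro ennreal_leI) (auto simp: a_def)
    finally show ?thesis .
  qed (use double_square_kernel_eq_0[OF a, of y] in auto)
  have "(\<integral>\<^sup>+y. q y \<partial>lborel) = (\<integral>\<^sup>+y. ennreal (J y) \<partial>lborel) - (\<integral>\<^sup>+y. ennreal p * ?u y \<partial>lborel)"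
    unfolding q_def using le
    by (intro nn_integral_diff) (auto simp: nn_integral_cmult nn_integral_double_square_kernel[OF a])
  also have "\<dots> = ennreal (1 - p)"
    using p by (simp add: nn_integral_J nn_integral_cmult nn_integral_double_square_kernel[OF a] ennreal_minus[symmetric])
  finally have q: "(\<integral>\<^sup>+y. q y \<partial>lborel) = ennreal (1 - p)" .
  have *: "(\<lambda>y. ennreal (J y)) = (\<lambda>y. ennreal p * ?u y + q y)"
    unfolding q_def using le by (intro ext) (simp add: add_diff_inverse_ennreal)
  have "\<exists>C>0. \<forall>k\<ge>1. \<forall>f\<in>borel_measurable borel. \<forall>x.
      (step ^^ k) f x \<le> ennreal (C / (real k + 1)) * (\<integral>\<^sup>+y. f y \<partial>lborel)"
  proof (rule correlate_funpow_split_bound[OF _ _ * p(1,2) q, where c = "2 / a\<^sup>2" and M = M])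
    show "(correlate ?u ^^ j) f x \<le> ennreal (2 / a\<^sup>2 / (real j + 1)) * (\<integral>\<^sup>+y. f y \<partial>lborel)"
      if "1 \<le> j" "f \<in> borel_measurable borel" for j f x
      by (rule double_square_kernel_funpow_bound[OF a that(2,1)])
  qed (use M in \<open>auto intro: ennreal_leI\<close>)
  then obtain C where "C > 0" "\<forall>k\<ge>1. \<forall>f\<in>borel_measurable borel. \<forall>x.
      (step ^^ k) f x \<le> ennreal (C / (real k + 1)) * (\<integral>\<^sup>+y. f y \<partial>lborel)"
    by blast
  then show thesis by (intro that[of C]) auto
qed

lemma nn_integral_step_funpow:
  assumes [measurable]: "f \<in> borel_measurable borel"
  shows "(\<integral>\<^sup>+x. (step ^^ n) f x \<partial>lborel) = (\<integral>\<^sup>+x. f x \<partial>lborel)"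
  by (induction n) (simp_all add: nn_integral_correlate nn_integral_J)

end

section \<open>The walk killed in the hole\<close>

lemma integrable_mult_bounded:
  fixes f g :: "'a \<Rightarrow> real"
  assumes "integrable M f" "g \<in> borel_measurable M" "\<And>x. \<bar>g x\<bar> \<le> B"
  shows "integrable M (\<lambda>x. f x * g x)"
proof (rule Bochner_Integration.integrable_bound)
  show "integrable M (\<lambda>x. B * \<bar>f x\<bar>)" using assms(1) by simp
  show "AE x in M. norm (f x * g x) \<le> norm (B * \<bar>f x\<bar>)"
  proof (intro AE_I2)
    fix x
    have "\<bar>f x\<bar> * \<bar>g x\<bar> \<le> \<bar>f x\<bar> * \<bar>B\<bar>"
      using assms(3)[of x] by (intro mult_left_mono) auto
    then show "norm (f x * g x) \<le> norm (B * \<bar>f x\<bar>)" by (simp add: abs_mult mult.commute)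
  qed
qed (use assms in measurable)

locale exterior_kernel = bump_kernel +
  fixes H :: "(real ^ 2) set"
  assumes H_sets [measurable]: "H \<in> sets borel"
begin

text \<open>Real-valued counterpart of \<open>step\<close>, for bounded functions of either
  sign.\<close>

definition avg :: "(real ^ 2 \<Rightarrow> real) \<Rightarrow> real ^ 2 \<Rightarrow> real" where
  "avg \<phi> x = (LINT y|lborel. J y * \<phi> (x + y))"

text \<open>Jumping into the hole needs no separate factor: test functions vanish there. The
  indicator kills walks that start in the hole and makes the image a test function again.\<close>

definition killed :: "(real ^ 2 \<Rightarrow> real) \<Rightarrow> real ^ 2 \<Rightarrow> real" where
  "killed \<phi> x = indicator (- H) x * avg \<phi> x"

text \<open>Both conditions hold at every point, so they survive all powers of \<open>killed\<close>
  with the same \<open>B\<close>. Vanishing in \<open>H\<close> is what allows testing an equation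
  that is known only outside \<open>H\<close>.\<close>

definition test :: "real \<Rightarrow> (real ^ 2 \<Rightarrow> real) \<Rightarrow> bool" where
  "test B \<phi> \<longleftrightarrow> \<phi> \<in> borel_measurable borel \<and> (\<forall>x. \<bar>\<phi> x\<bar> \<le> B) \<and> (\<forall>x\<in>H. \<phi> x = 0)"

lemma test_measurable [measurable_dest]: "test B \<phi> \<Longrightarrow> \<phi> \<in> borel_measurable borel"
  and test_bound: "test B \<phi> \<Longrightarrow> \<bar>\<phi> x\<bar> \<le> B"
  by (auto simp: test_def)

lemma test_bound_nonneg: "test B \<phi> \<Longrightarrow> 0 \<le> B"
  using test_bound[of B \<phi> 0] by linarith

lemma avg_integrable:
  assumes "\<phi> \<in> borel_measurable borel" "\<And>x. \<bar>\<phi> x\<bar> \<le> B"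
  shows "integrable lborel (\<lambda>y. J y * \<phi> (x + y))"
  using assms by (intro integrable_mult_bounded[where B = B]) auto

lemma avg_measurable [measurable]:
  assumes [measurable]: "\<phi> \<in> borel_measurable borel"
  shows "avg \<phi> \<in> borel_measurable borel"
  unfolding avg_def[abs_def] by measurable

lemma avg_mono:
  assumes "\<phi> \<in> borel_measurable borel" "\<And>x. \<bar>\<phi> x\<bar> \<le> B"
    and "\<psi> \<in> borel_measurable borel" "\<And>x. \<bar>\<psi> x\<bar> \<le> B'" and "\<And>x. \<phi> x \<le> \<psi> x"
  shows "avg \<phi> x \<le> avg \<psi> x"
  unfolding avg_def using assms
  by (intro integral_mono avg_integrable[of _ B] avg_integrable[of _ B'] mult_left_mono J_nonneg) auto

lemma avg_const [simp]: "avg (\<lambda>_. c) x = c"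
  by (simp add: avg_def J_int)

lemma avg_bound:
  assumes "\<phi> \<in> borel_measurable borel" "\<And>x. \<bar>\<phi> x\<bar> \<le> B"
  shows "\<bar>avg \<phi> x\<bar> \<le> B"
proof -
  have "\<phi> y \<le> B" "- B \<le> \<phi> y" "0 \<le> B" for y using assms(2)[of y] by (auto simp: abs_le_iff)
  then have "avg \<phi> x \<le> avg (\<lambda>_. B) x" "avg (\<lambda>_. - B) x \<le> avg \<phi> x"
    using assms by (intro avg_mono[of _ B _ B]; auto)+
  then show ?thesis by simp
qed

lemma test_killed: "test B \<phi> \<Longrightarrow> test B (killed \<phi>)"
  using avg_bound[of \<phi> B] test_bound_nonneg[of B \<phi>] unfolding test_def killed_def[abs_def]
  by (auto simp: indicator_def)

lemma test_killed_funpow: "test B \<phi> \<Longrightarrow> test B ((killed ^^ k) \<phi>)"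
  by (induction k) (auto simp: test_killed)

lemma killed_mono:
  assumes "test B \<phi>" "test B' \<psi>" "\<And>x. \<phi> x \<le> \<psi> x"
  shows "killed \<phi> x \<le> killed \<psi> x"
  using assms unfolding killed_def by (intro mult_left_mono avg_mono[of _ B _ B']) (auto simp: test_def)

lemma killed_nonneg:
  assumes "\<And>x. 0 \<le> \<phi> x"
  shows "0 \<le> killed \<phi> x"
  using assms unfolding killed_def avg_def by (auto simp: J_nonneg intro!: mult_nonneg_nonneg integral_nonneg)

lemma killed_funpow_nonneg:
  assumes "\<And>x. 0 \<le> \<phi> x"
  shows "0 \<le> (killed ^^ k) \<phi> x"
  by (induction k arbitrary: x) (auto simp: assms killed_nonneg)

text \<open>\<open>killed\<close> is monotone, so one step of decrease can be iterated.\<close>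

lemma killed_funpow_le:
  assumes "test B \<phi>" "\<And>x. killed \<phi> x \<le> \<phi> x"
  shows "(killed ^^ k) \<phi> x \<le> \<phi> x"
proof (induction k arbitrary: x)
  case (Suc k)
  have "(killed ^^ Suc k) \<phi> x \<le> killed \<phi> x"
    using killed_mono[OF test_killed_funpow[OF assms(1)] assms(1) Suc] by simp
  with assms(2)[of x] show ?case by linarith
qed simp

text \<open>Forgetting the hole only increases nonnegative functions; this carries the bounds for
  \<open>step\<close> over to \<open>killed\<close>.\<close>

lemma killed_funpow_le_step:
  assumes "test B \<phi>" "\<And>x. 0 \<le> \<phi> x"
  shows "ennreal ((killed ^^ k) \<phi> x) \<le> (step ^^ k) (\<lambda>x. ennreal (\<phi> x)) x"
proof (induction k arbitrary: x)
  case (Suc k)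
  let ?g = "(killed ^^ k) \<phi>"
  have g: "test B ?g" by (rule test_killed_funpow[OF assms(1)])
  have "ennreal ((killed ^^ Suc k) \<phi> x) \<le> ennreal (avg ?g x)"
    using killed_funpow_nonneg[OF assms(2), of k]
    by (intro ennreal_leI) (auto simp: killed_def avg_def indicator_def J_nonneg intro!: integral_nonneg)
  also have "\<dots> = (\<integral>\<^sup>+y. ennreal (J y * ?g (x + y)) \<partial>lborel)"
    unfolding avg_def using killed_funpow_nonneg[OF assms(2), of k] g
    by (intro nn_integral_eq_integral[symmetric] avg_integrable[of _ B]) (auto simp: test_def J_nonneg)
  also have "\<dots> = step (\<lambda>x. ennreal (?g x)) x"
    unfolding correlate_def using killed_funpow_nonneg[OF assms(2), of k] by (simp add: ennreal_mult J_nonneg)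
  also have "\<dots> \<le> step ((step ^^ k) (\<lambda>x. ennreal (\<phi> x))) x"
    by (rule correlate_mono) (rule Suc)
  finally show ?case by simp
qed simp

text \<open>The operator \<^const>\<open>avg\<close> on bounded functions is the transpose of the convolution with \<open>J\<close>.\<close>

lemma
  assumes g: "integrable lborel g"
  shows integrable_convolution: "integrable lborel (\<lambda>x. LINT y|lborel. J (x - y) * g y)"
    and integral_convolution_mult:
      "\<phi> \<in> borel_measurable borel \<Longrightarrow> (\<And>x. \<bar>\<phi> x\<bar> \<le> B) \<Longrightarrow>
       (LINT x|lborel. (LINT y|lborel. J (x - y) * g y) * \<phi> x) = (LINT y|lborel. g y * avg \<phi> y)"
proof -
  have [measurable]: "g \<in> borel_measurable borel" using borel_measurable_integrable[OF g] by simp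
  have shift: "(LINT x|lborel. J (x - y) * \<psi> x) = avg \<psi> y" "integrable lborel (\<lambda>x. J (x - y) * \<psi> x)"
    if [measurable]: "\<psi> \<in> borel_measurable borel" and B: "\<And>x. \<bar>\<psi> x\<bar> \<le> B" for \<psi> y B
  proof -
    have "avg \<psi> y = (LINT x|lborel. J x * \<psi> (x + y))"
      by (simp add: avg_def add.commute)
    also have "\<dots> = (LINT x|distr lborel borel ((+) y). J (x - y) * \<psi> x)"
      by (subst integral_distr) (auto simp: add.commute)
    finally show "(LINT x|lborel. J (x - y) * \<psi> x) = avg \<psi> y" by (simp add: lborel_distr_plus)
    have "integrable (distr lborel borel ((+) y)) (\<lambda>x. J (x - y) * \<psi> x)"
      using avg_integrable[OF that, of y] by (subst integrable_distr_eq) (auto simp: add.commute)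
    then show "integrable lborel (\<lambda>x. J (x - y) * \<psi> x)" by (simp add: lborel_distr_plus)
  qed
  \<comment> \<open>Applied with \<open>\<psi> = 1\<close> for the integrability of the convolution
    and with \<open>\<psi> = \<phi>\<close> for Fubini.\<close>
  have int: "integrable (lborel \<Otimes>\<^sub>M lborel) (\<lambda>(y, x). g y * (J (x - y) * \<psi> x))"
    if [measurable]: "\<psi> \<in> borel_measurable borel" and B: "\<And>x. \<bar>\<psi> x\<bar> \<le> B" for \<psi> B
  proof (rule lborel_pair.Fubini_integrable)
    show "(\<lambda>(y, x). g y * (J (x - y) * \<psi> x)) \<in> borel_measurable (lborel \<Otimes>\<^sub>M lborel)" by measurable
    have "integrable lborel (\<lambda>y. \<bar>g y\<bar> * avg (\<lambda>x. \<bar>\<psi> x\<bar>) y)"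
      using g B by (intro integrable_mult_bounded[where B = B] avg_bound) auto
    moreover have "\<bar>g y\<bar> * avg (\<lambda>x. \<bar>\<psi> x\<bar>) y = (LINT x|lborel. norm (case (y, x) of (y, x) \<Rightarrow> g y * (J (x - y) * \<psi> x)))" for y
      using shift(1)[of "\<lambda>x. \<bar>\<psi> x\<bar>" B y] B by (simp add: abs_mult J_nonneg)
    ultimately show "integrable lborel (\<lambda>y. LINT x|lborel. norm (case (y, x) of (y, x) \<Rightarrow> g y * (J (x - y) * \<psi> x)))"
      by simp
    show "AE y in lborel. integrable lborel (\<lambda>x. case (y, x) of (y, x) \<Rightarrow> g y * (J (x - y) * \<psi> x))"
      using shift(2)[OF that] by simp
  qed
  have "integrable lborel (\<lambda>x. LINT y|lborel. g y * (J (x - y) * 1))"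
    using lborel_pair.integrable_snd[OF int[of "\<lambda>_. 1" 1]] by simp
  then show "integrable lborel (\<lambda>x. LINT y|lborel. J (x - y) * g y)"
    by (simp add: mult.commute)
  assume \<phi>: "\<phi> \<in> borel_measurable borel" "\<And>x. \<bar>\<phi> x\<bar> \<le> B"
  have "(LINT x|lborel. (LINT y|lborel. J (x - y) * g y) * \<phi> x) = (LINT x|lborel. LINT y|lborel. g y * (J (x - y) * \<phi> x))"
    by (subst integral_mult_left_zero[symmetric]) (simp add: mult_ac)
  also have "\<dots> = (LINT y|lborel. LINT x|lborel. g y * (J (x - y) * \<phi> x))"
    by (rule lborel_pair.Fubini_integral[OF int[OF \<phi>]])
  also have "\<dots> = (LINT y|lborel. g y * avg \<phi> y)"
    by (simp add: shift(1)[OF \<phi>])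
  finally show "(LINT x|lborel. (LINT y|lborel. J (x - y) * g y) * \<phi> x) = (LINT y|lborel. g y * avg \<phi> y)" .
qed

end

section \<open>Solutions tested against bounded functions\<close>

text \<open>Passes from \<open>ennreal\<close>-valued L1 distances to limits of real
  pairings.\<close>

lemma tendsto_0_ennreal_dominated:
  fixes f :: "'b \<Rightarrow> real" and g :: "'b \<Rightarrow> ennreal"
  assumes "(g \<longlongrightarrow> 0) F" "eventually (\<lambda>x. ennreal \<bar>f x\<bar> \<le> ennreal B * g x) F"
  shows "(f \<longlongrightarrow> 0) F"
proof -
  have "((\<lambda>x. ennreal B * g x) \<longlongrightarrow> ennreal B * 0) F"
    using assms(1) by (intro tendsto_mult_ennreal tendsto_const) auto
  then have "((\<lambda>x. ennreal B * g x) \<longlongrightarrow> 0) F" by simp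
  then have "((\<lambda>x. ennreal \<bar>f x\<bar>) \<longlongrightarrow> 0) F"
    using tendsto_sandwich[OF _ assms(2) tendsto_const] by simp
  then have "((\<lambda>x. ennreal \<bar>f x\<bar>) \<longlongrightarrow> ennreal 0) F" by simp
  then have "((\<lambda>x. \<bar>f x\<bar>) \<longlongrightarrow> 0) F"
    by (subst (asm) tendsto_ennreal_iff) auto
  then show ?thesis by (rule tendsto_rabs_zero_cancel)
qed

lemma abs_integral_mult_le:
  assumes "integrable M f" "g \<in> borel_measurable M" "\<And>x. \<bar>g x\<bar> \<le> B" "\<And>x. x \<notin> A \<Longrightarrow> g x = 0"
  shows "ennreal \<bar>LINT x|M. f x * g x\<bar> \<le> ennreal B * (\<integral>\<^sup>+x\<in>A. ennreal \<bar>f x\<bar> \<partial>M)"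
proof (cases "integrable M (\<lambda>x. f x * g x)")
  case True
  have [measurable]: "f \<in> borel_measurable M" using assms(1) by simp
  note [measurable] = assms(2)
  have "ennreal \<bar>LINT x|M. f x * g x\<bar> \<le> (\<integral>\<^sup>+x. ennreal \<bar>f x * g x\<bar> \<partial>M)"
    using integral_norm_bound_ennreal[OF True] by simp
  \<comment> \<open>Nothing is assumed about the measurability of \<open>A\<close>, so the constant
    is pulled out with the measurable set \<open>{x. g x \<noteq> 0}\<close>, which is enlarged to
    \<open>A\<close> afterwards.\<close>
  also have "\<dots> \<le> (\<integral>\<^sup>+x. ennreal B * ennreal (\<bar>f x\<bar> * indicator {x. g x \<noteq> 0} x) \<partial>M)"
  proof (intro nn_integral_mono)
    fix x
    have "0 \<le> B" using assms(3)[of x] by linarith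
    then have "ennreal B * ennreal (\<bar>f x\<bar> * indicator {x. g x \<noteq> 0} x) = ennreal (B * (\<bar>f x\<bar> * indicator {x. g x \<noteq> 0} x))"
      by (subst ennreal_mult) auto
    moreover have "\<bar>f x * g x\<bar> \<le> B * (\<bar>f x\<bar> * indicator {x. g x \<noteq> 0} x)"
      using mult_left_mono[OF assms(3)[of x], of "\<bar>f x\<bar>"] by (simp add: abs_mult indicator_def mult.commute)
    ultimately show "ennreal \<bar>f x * g x\<bar> \<le> ennreal B * ennreal (\<bar>f x\<bar> * indicator {x. g x \<noteq> 0} x)"
      by (simp add: ennreal_leI)
  qed
  also have "\<dots> = ennreal B * (\<integral>\<^sup>+x. ennreal (\<bar>f x\<bar> * indicator {x. g x \<noteq> 0} x) \<partial>M)"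
  proof -
    have *: "(\<lambda>x. ennreal (\<bar>f x\<bar> * indicator {x. g x \<noteq> 0} x)) = (\<lambda>x. ennreal (if g x = 0 then 0 else \<bar>f x\<bar>))"
      by (intro ext) simp
    have "(\<lambda>x. ennreal (\<bar>f x\<bar> * indicator {x. g x \<noteq> 0} x)) \<in> borel_measurable M"
      unfolding * by measurable
    then show ?thesis by (rule nn_integral_cmult)
  qed
  also have "\<dots> \<le> ennreal B * (\<integral>\<^sup>+x\<in>A. ennreal \<bar>f x\<bar> \<partial>M)"
    using assms(4) by (intro mult_left_mono nn_integral_mono) (auto simp: indicator_def)
  finally show ?thesis .
qed (simp add: not_integrable_integral_eq)

text \<open>The values \<open>w t\<close> are Borel representatives of an L1 curve that solves the exterior problem.\<close>

locale exterior_solution = exterior_kernel +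
  fixes w :: "real \<Rightarrow> real ^ 2 \<Rightarrow> real"
  assumes w_integrable: "0 \<le> t \<Longrightarrow> integrable lborel (w t)"
    and w_zero: "0 \<le> t \<Longrightarrow> AE x in lborel. x \<in> H \<longrightarrow> w t x = 0"
    and w_cont: "0 \<le> t \<Longrightarrow>
      ((\<lambda>s. \<integral>\<^sup>+x. ennreal \<bar>w s x - w t x\<bar> \<partial>lborel) \<longlongrightarrow> 0) (at t within {0..})"
    and w_deriv: "0 < t \<Longrightarrow>
      ((\<lambda>h. \<integral>\<^sup>+x\<in>-H. ennreal \<bar>(w (t + h) x - w t x) / h - ((LINT y|lborel. J (x - y) * w t y) - w t x)\<bar> \<partial>lborel) \<longlongrightarrow> 0) (at 0)"
begin

definition pair :: "real \<Rightarrow> (real ^ 2 \<Rightarrow> real) \<Rightarrow> real" where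
  "pair t \<phi> = (LINT x|lborel. w t x * \<phi> x)"

lemma w_measurable: "0 \<le> t \<Longrightarrow> w t \<in> borel_measurable borel"
  using borel_measurable_integrable[OF w_integrable] by simp

lemma pair_integrable: "0 \<le> t \<Longrightarrow> test B \<phi> \<Longrightarrow> integrable lborel (\<lambda>x. w t x * \<phi> x)"
  by (rule integrable_mult_bounded[OF w_integrable]) (auto simp: test_def)

text \<open>The indicator of \<open>- H\<close> may be dropped because \<open>w t\<close> vanishes
  in \<open>H\<close>; what is left is the transposition
  \<open>integral_convolution_mult\<close>.\<close>

lemma pair_killed:
  assumes t: "0 \<le> t" and \<phi>: "test B \<phi>"
  shows "pair t (killed \<phi>) = (LINT x|lborel. (LINT y|lborel. J (x - y) * w t y) * \<phi> x)"
proof -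
  have [measurable]: "\<phi> \<in> borel_measurable borel" "w t \<in> borel_measurable borel"
    using \<phi> w_measurable[OF t] by (auto simp: test_def)
  have "pair t (killed \<phi>) = (LINT x|lborel. w t x * avg \<phi> x)"
    unfolding pair_def killed_def using w_zero[OF t]
    by (intro integral_cong_AE) (auto simp: indicator_def elim!: eventually_mono)
  then show ?thesis
    using \<phi> by (subst integral_convolution_mult[OF w_integrable[OF t], of _ B]) (auto simp: test_def)
qed

lemma pair_tendsto:
  assumes t: "0 \<le> t" and \<phi>: "test B \<phi>"
  shows "((\<lambda>s. pair s \<phi>) \<longlongrightarrow> pair t \<phi>) (at t within {0..})"
proof -
  have "((\<lambda>s. pair s \<phi> - pair t \<phi>) \<longlongrightarrow> 0) (at t within {0..})"
  proof (rule tendsto_0_ennreal_dominated[OF w_cont[OF t]])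
    show "\<forall>\<^sub>F s in at t within {0..}. ennreal \<bar>pair s \<phi> - pair t \<phi>\<bar>
        \<le> ennreal B * (\<integral>\<^sup>+x. ennreal \<bar>w s x - w t x\<bar> \<partial>lborel)"
      unfolding eventually_at_filter
    proof (intro always_eventually allI impI)
      fix s :: real assume s: "s \<in> {0..}"
      then have "pair s \<phi> - pair t \<phi> = (LINT x|lborel. (w s x - w t x) * \<phi> x)"
        unfolding pair_def left_diff_distrib using pair_integrable[OF _ \<phi>] t
        by (subst Bochner_Integration.integral_diff) auto
      then show "ennreal \<bar>pair s \<phi> - pair t \<phi>\<bar> \<le> ennreal B * (\<integral>\<^sup>+x. ennreal \<bar>w s x - w t x\<bar> \<partial>lborel)"
        using abs_integral_mult_le[of lborel "\<lambda>x. w s x - w t x" \<phi> B UNIV] w_integrable s t \<phi>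
        by (auto simp: test_def)
    qed
  qed
  then show ?thesis by (rule LIM_zero_cancel)
qed

lemma pair_continuous:
  assumes "test B \<phi>"
  shows "continuous_on {0..} (\<lambda>t. pair t \<phi>)"
  unfolding continuous_on_def using pair_tendsto[OF _ assms] by auto

text \<open>The L1 derivative is known only on \<open>- H\<close>; this suffices because
  \<open>\<phi>\<close> vanishes in \<open>H\<close>.\<close>

lemma pair_derivative:
  assumes t: "0 < t" and \<phi>: "test B \<phi>"
  shows "((\<lambda>t. pair t \<phi>) has_real_derivative (pair t (killed \<phi>) - pair t \<phi>)) (at t)"
proof -
  let ?c = "\<lambda>x. LINT y|lborel. J (x - y) * w t y"
  have t0: "0 \<le> t" using t by simp
  note ic = integrable_convolution[OF w_integrable[OF t0]]
  note iw = pair_integrable[OF _ \<phi>]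
  have icm: "integrable lborel (\<lambda>x. ?c x * \<phi> x)"
    by (rule integrable_mult_bounded[OF ic]) (use \<phi> in \<open>auto simp: test_def\<close>)
  have "((\<lambda>h. (pair (t + h) \<phi> - pair t \<phi>) / h - (pair t (killed \<phi>) - pair t \<phi>)) \<longlongrightarrow> 0) (at 0)"
  proof (rule tendsto_0_ennreal_dominated[OF w_deriv[OF t]])
    \<comment> \<open>\<open>w\<close> is controlled at nonnegative times only, so \<open>h\<close>
      must satisfy \<open>0 \<le> t + h\<close>.\<close>
    have "\<forall>\<^sub>F h in at 0. \<bar>h\<bar> < t"
      unfolding eventually_at using t by (auto intro!: exI[of _ t] simp: dist_norm)
    then show "\<forall>\<^sub>F h in at 0. ennreal \<bar>(pair (t + h) \<phi> - pair t \<phi>) / h - (pair t (killed \<phi>) - pair t \<phi>)\<bar>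
        \<le> ennreal B * (\<integral>\<^sup>+x\<in>-H. ennreal \<bar>(w (t + h) x - w t x) / h - (?c x - w t x)\<bar> \<partial>lborel)"
    proof (rule eventually_mono)
      fix h :: real assume "\<bar>h\<bar> < t"
      then have h: "0 \<le> t + h" by linarith
      let ?f = "\<lambda>x. (w (t + h) x - w t x) / h - (?c x - w t x)"
      have "(pair (t + h) \<phi> - pair t \<phi>) / h - (pair t (killed \<phi>) - pair t \<phi>)
         = (LINT x|lborel. (w (t + h) x * \<phi> x - w t x * \<phi> x) / h - (?c x * \<phi> x - w t x * \<phi> x))"
        unfolding pair_killed[OF t0 \<phi>] unfolding pair_def
        using iw[OF h] iw[OF t0] icm by simp
      also have "\<dots> = (LINT x|lborel. ?f x * \<phi> x)"
        by (intro Bochner_Integration.integral_cong) (auto simp: algebra_simps diff_divide_distrib)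
      finally show "ennreal \<bar>(pair (t + h) \<phi> - pair t \<phi>) / h - (pair t (killed \<phi>) - pair t \<phi>)\<bar>
        \<le> ennreal B * (\<integral>\<^sup>+x\<in>-H. ennreal \<bar>?f x\<bar> \<partial>lborel)"
        using abs_integral_mult_le[of lborel ?f \<phi> B "- H"] w_integrable[OF h] w_integrable[OF t0] ic \<phi>
        by (auto simp: test_def)
    qed
  qed
  then show ?thesis
    unfolding DERIV_def by (rule LIM_zero_cancel)
qed

text \<open>Supplies the bound, uniform on a compact time interval, that
  \<open>poisson_series\<close> asks for.\<close>

lemma L1_norm_bounded:
  assumes s: "0 \<le> s"
  obtains C where "\<And>r. s \<le> r \<Longrightarrow> r \<le> t \<Longrightarrow> (LINT x|lborel. \<bar>w r x\<bar>) \<le> C"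
proof -
  have "((\<lambda>r. LINT x|lborel. \<bar>w r x\<bar>) \<longlongrightarrow> (LINT x|lborel. \<bar>w q x\<bar>)) (at q within {0..})" if q: "0 \<le> q" for q
  proof -
    have "((\<lambda>r. (LINT x|lborel. \<bar>w r x\<bar>) - (LINT x|lborel. \<bar>w q x\<bar>)) \<longlongrightarrow> 0) (at q within {0..})"
    proof (rule tendsto_0_ennreal_dominated[OF w_cont[OF q]])
      show "\<forall>\<^sub>F r in at q within {0..}. ennreal \<bar>(LINT x|lborel. \<bar>w r x\<bar>) - (LINT x|lborel. \<bar>w q x\<bar>)\<bar>
        \<le> ennreal 1 * (\<integral>\<^sup>+x. ennreal \<bar>w r x - w q x\<bar> \<partial>lborel)"
        unfolding eventually_at_filter
      proof (intro always_eventually allI impI)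
        fix r :: real assume "r \<in> {0..}"
        then have r: "0 \<le> r" by simp
        note i = w_integrable[OF r] w_integrable[OF q]
        have "\<bar>(LINT x|lborel. \<bar>w r x\<bar>) - (LINT x|lborel. \<bar>w q x\<bar>)\<bar> = \<bar>LINT x|lborel. \<bar>w r x\<bar> - \<bar>w q x\<bar>\<bar>"
          using i by (subst Bochner_Integration.integral_diff) auto
        also have "\<dots> \<le> (LINT x|lborel. \<bar>\<bar>w r x\<bar> - \<bar>w q x\<bar>\<bar>)"
          using i by (intro integral_abs_bound)
        also have "\<dots> \<le> (LINT x|lborel. \<bar>w r x - w q x\<bar>)"
          using i by (intro integral_mono) auto
        finally have "ennreal \<bar>(LINT x|lborel. \<bar>w r x\<bar>) - (LINT x|lborel. \<bar>w q x\<bar>)\<bar> \<le> ennreal (LINT x|lborel. \<bar>w r x - w q x\<bar>)"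
          by (rule ennreal_leI)
        also have "\<dots> = (\<integral>\<^sup>+x. ennreal \<bar>w r x - w q x\<bar> \<partial>lborel)"
          using i by (subst nn_integral_eq_integral) auto
        finally show "ennreal \<bar>(LINT x|lborel. \<bar>w r x\<bar>) - (LINT x|lborel. \<bar>w q x\<bar>)\<bar>
            \<le> ennreal 1 * (\<integral>\<^sup>+x. ennreal \<bar>w r x - w q x\<bar> \<partial>lborel)" by simp
      qed
    qed
    then show ?thesis by (rule LIM_zero_cancel)
  qed
  then have "continuous_on {0..} (\<lambda>r. LINT x|lborel. \<bar>w r x\<bar>)"
    unfolding continuous_on_def by auto
  then have "continuous_on {s..t} (\<lambda>r. LINT x|lborel. \<bar>w r x\<bar>)"
    by (rule continuous_on_subset) (use s in auto)
  then have "bounded ((\<lambda>r. LINT x|lborel. \<bar>w r x\<bar>) ` {s..t})"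
    by (intro compact_imp_bounded compact_continuous_image) auto
  then obtain C where "\<forall>y\<in>(\<lambda>r. LINT x|lborel. \<bar>w r x\<bar>) ` {s..t}. norm y \<le> C"
    unfolding bounded_iff by blast
  then show thesis
    by (intro that[of C]) auto
qed

text \<open>The pairings with \<open>(killed ^^ k) \<phi>\<close> form the hierarchy of
  \<open>poisson_series\<close>: \<open>pair_derivative\<close> links index \<open>k\<close> to
  \<open>k + 1\<close>, and all these test functions share the bound \<open>B\<close>.\<close>

lemma pair_series:
  assumes st: "0 \<le> s" "s \<le> t" and \<phi>: "test B \<phi>"
  shows "(\<lambda>k. (t - s) ^ k / fact k * pair s ((killed ^^ k) \<phi>)) sums (exp (t - s) * pair t \<phi>)"
proof -
  obtain C where C: "\<And>r. s \<le> r \<Longrightarrow> r \<le> t \<Longrightarrow> (LINT x|lborel. \<bar>w r x\<bar>) \<le> C"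
    using L1_norm_bounded[OF st(1)] by blast
  have B: "0 \<le> B" using test_bound_nonneg[OF \<phi>] .
  have "(\<lambda>k. (t - s) ^ k / fact k * pair s ((killed ^^ k) \<phi>)) sums (exp (t - s) * pair t ((killed ^^ 0) \<phi>))"
  proof (rule poisson_series[where m = "\<lambda>k r. pair r ((killed ^^ k) \<phi>)" and C = "C * B"])
    fix k
    show "continuous_on {s..t} (\<lambda>r. pair r ((killed ^^ k) \<phi>))"
      by (rule continuous_on_subset[OF pair_continuous[OF test_killed_funpow[OF \<phi>]]]) (use st in auto)
    fix r
    show "((\<lambda>r. pair r ((killed ^^ k) \<phi>)) has_real_derivative pair r ((killed ^^ Suc k) \<phi>) - pair r ((killed ^^ k) \<phi>)) (at r)"
      if "s < r" "r < t"
      using pair_derivative[OF _ test_killed_funpow[OF \<phi>], of r k] that st by simp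
    assume r: "s \<le> r" "r \<le> t"
    with st have r0: "0 \<le> r" by simp
    have "\<bar>pair r ((killed ^^ k) \<phi>)\<bar> \<le> (LINT x|lborel. \<bar>w r x * (killed ^^ k) \<phi> x\<bar>)"
      unfolding pair_def by (rule integral_abs_bound)
    also have "\<dots> \<le> (LINT x|lborel. \<bar>w r x\<bar> * B)"
      using w_integrable[OF r0] integrable_abs[OF pair_integrable[OF r0 test_killed_funpow[OF \<phi>]]]
        test_bound[OF test_killed_funpow[OF \<phi>]]
      unfolding abs_mult by (intro integral_mono mult_left_mono) auto
    also have "\<dots> \<le> C * B" using C[OF r] B by (auto intro!: mult_right_mono)
    finally show "\<bar>pair r ((killed ^^ k) \<phi>)\<bar> \<le> C * B" .
  qed (use st in auto)
  then show ?thesis by simp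
qed

end

section \<open>Comparison and smoothing\<close>

text \<open>\<open>A\<close> is a Poisson average of the \<open>a k\<close>, since the weights
  \<open>\<tau> ^ k / fact k\<close> sum to \<open>exp \<tau>\<close>.\<close>

lemma exp_series_le:
  fixes a :: "nat \<Rightarrow> real"
  assumes sums: "(\<lambda>k. \<tau> ^ k / fact k * a k) sums (exp \<tau> * A)" and "0 \<le> \<tau>" and le: "\<And>k. a k \<le> b"
  shows "A \<le> b"
proof -
  have "(\<lambda>k. \<tau> ^ k / fact k * b) sums (exp \<tau> * b)"
    using sums_mult2[OF exp_converges[of \<tau>], of b] by (simp add: field_simps)
  note b = this
  have "\<tau> ^ k / fact k * a k \<le> \<tau> ^ k / fact k * b" for k
    using \<open>0 \<le> \<tau>\<close> by (intro mult_left_mono le) auto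
  then have "exp \<tau> * A \<le> exp \<tau> * b"
    by (rule sums_le[OF _ sums b])
  then show ?thesis by simp
qed

locale nonneg_exterior_solution = exterior_solution +
  assumes w0_nonneg: "AE x in lborel. 0 \<le> w 0 x"
begin

lemma test_indicator: "A \<in> sets borel \<Longrightarrow> A \<inter> H = {} \<Longrightarrow> test 1 (indicator A)"
  unfolding test_def by (intro conjI ballI allI borel_measurable_indicator) (auto simp: indicator_def)

lemma pair_nonneg:
  assumes t: "0 \<le> t" and \<phi>: "test B \<phi>" "\<And>x. 0 \<le> \<phi> x"
  shows "0 \<le> pair t \<phi>"
proof -
  have "0 \<le> pair 0 ((killed ^^ k) \<phi>)" for k
    unfolding pair_def using w0_nonneg killed_funpow_nonneg[OF \<phi>(2)]
    by (intro integral_nonneg_AE) (auto elim!: eventually_mono)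
  \<comment> \<open>Negated, because \<open>exp_series_le\<close> yields upper bounds.\<close>
  then show ?thesis
    using exp_series_le[of t "\<lambda>k. - pair 0 ((killed ^^ k) \<phi>)" "- pair t \<phi>" 0]
      sums_minus[OF pair_series[OF _ t \<phi>(1)]] t by simp
qed

text \<open>Test with the indicator of the negativity set outside the hole.\<close>

lemma w_nonneg:
  assumes t: "0 \<le> t"
  shows "AE x in lborel. 0 \<le> w t x"
proof -
  have [measurable]: "w t \<in> borel_measurable borel" by (rule w_measurable[OF t])
  define A where "A = {x. w t x < 0} - H"
  have A [measurable]: "A \<in> sets borel" unfolding A_def by measurable
  define \<phi> :: "real ^ 2 \<Rightarrow> real" where "\<phi> = indicator A"
  have \<phi>: "test 1 \<phi>" unfolding \<phi>_def by (rule test_indicator[OF A]) (auto simp: A_def)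
  have le: "w t x * \<phi> x \<le> 0" for x by (auto simp: \<phi>_def A_def indicator_def)
  have "0 \<le> pair t \<phi>" by (rule pair_nonneg[OF t \<phi>]) (auto simp: \<phi>_def)
  moreover have "0 \<le> (LINT x|lborel. - (w t x * \<phi> x))" using le by (intro Bochner_Integration.integral_nonneg) (simp add: le)
  ultimately have "(LINT x|lborel. - (w t x * \<phi> x)) = 0" by (simp add: pair_def)
  then have "AE x in lborel. - (w t x * \<phi> x) = 0"
    using le pair_integrable[OF t \<phi>] by (subst (asm) integral_nonneg_eq_0_iff_AE) auto
  with w_zero[OF t] show ?thesis
    by eventually_elim (auto simp: \<phi>_def A_def indicator_def split: if_splits)
qed

text \<open>Duality: with the indicator of \<open>{x. K < w t x} - H\<close> as test function, the
  integral of \<open>w t x - K\<close> over this set is both nonnegative and nonpositive.\<close>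

lemma w_le:
  assumes t: "0 \<le> t" and "0 < K"
    and le: "\<And>\<phi>. test 1 \<phi> \<Longrightarrow> (\<And>x. 0 \<le> \<phi> x) \<Longrightarrow> integrable lborel \<phi> \<Longrightarrow> pair t \<phi> \<le> K * (LINT x|lborel. \<phi> x)"
  shows "AE x in lborel. w t x \<le> K"
proof -
  have [measurable]: "w t \<in> borel_measurable borel" by (rule w_measurable[OF t])
  define A where "A = {x. K < w t x} - H"
  have A [measurable]: "A \<in> sets borel" unfolding A_def by measurable
  define \<phi> :: "real ^ 2 \<Rightarrow> real" where "\<phi> = indicator A"
  have \<phi>: "test 1 \<phi>" unfolding \<phi>_def by (rule test_indicator[OF A]) (auto simp: A_def)
  \<comment> \<open>Chebyshev's argument: the indicator is dominated by
    \<open>\<bar>w t x\<bar> / K\<close>.\<close>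
  have i: "integrable lborel \<phi>"
  proof (rule Bochner_Integration.integrable_bound)
    show "integrable lborel (\<lambda>x. w t x / K)" using w_integrable[OF t] by simp
    show "AE x in lborel. norm (\<phi> x) \<le> norm (w t x / K)"
      using \<open>0 < K\<close> by (auto simp: \<phi>_def A_def indicator_def field_simps)
  qed (auto simp: \<phi>_def)
  have ge: "0 \<le> w t x * \<phi> x - K * \<phi> x" for x by (auto simp: \<phi>_def A_def indicator_def)
  have i2: "integrable lborel (\<lambda>x. w t x * \<phi> x - K * \<phi> x)"
    using i pair_integrable[OF t \<phi>] by auto
  have "pair t \<phi> \<le> K * (LINT x|lborel. \<phi> x)"
    by (rule le[OF \<phi> _ i]) (auto simp: \<phi>_def)
  then have "(LINT x|lborel. w t x * \<phi> x - K * \<phi> x) \<le> 0"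
    using i pair_integrable[OF t \<phi>] by (simp add: pair_def)
  then have "(LINT x|lborel. w t x * \<phi> x - K * \<phi> x) = 0"
    using ge by (intro antisym Bochner_Integration.integral_nonneg) auto
  then have "AE x in lborel. w t x * \<phi> x - K * \<phi> x = 0"
    using ge i2 by (subst (asm) integral_nonneg_eq_0_iff_AE) auto
  with w_zero[OF t] show ?thesis
    by eventually_elim (use \<open>0 < K\<close> in \<open>auto simp: \<phi>_def A_def indicator_def split: if_splits\<close>)
qed

lemma pair_mono:
  assumes "0 \<le> t" "test B \<phi>" "test B' \<psi>" "\<And>x. \<phi> x \<le> \<psi> x"
  shows "pair t \<phi> \<le> pair t \<psi>"
  unfolding pair_def using w_nonneg[OF assms(1)]
  by (intro integral_mono_AE pair_integrable[OF assms(1,2)] pair_integrable[OF assms(1,3)])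
     (auto elim!: eventually_mono intro!: mult_left_mono assms)

text \<open>Supermartingale property: every coefficient \<open>pair s ((killed ^^ k) \<phi>)\<close>
  is at most the one with \<open>k = 0\<close>.\<close>

lemma pair_superharmonic_le:
  assumes st: "0 \<le> s" "s \<le> t" and \<phi>: "test B \<phi>" and super: "\<And>x. killed \<phi> x \<le> \<phi> x"
  shows "pair t \<phi> \<le> pair s \<phi>"
proof (rule exp_series_le[OF pair_series[OF st \<phi>]])
  show "pair s ((killed ^^ k) \<phi>) \<le> pair s \<phi>" for k
    by (rule pair_mono[OF st(1) test_killed_funpow[OF \<phi>] \<phi> killed_funpow_le[OF \<phi> super]])
qed (use st in simp)

lemma pair_le_sup:
  assumes t: "0 \<le> t" and \<phi>: "test B \<phi>" "\<And>x. 0 \<le> \<phi> x" "integrable lborel \<phi>"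
    and K: "AE x in lborel. w t x \<le> K" "0 \<le> K"
  shows "pair t \<phi> \<le> K * (LINT x|lborel. \<phi> x)"
proof -
  have "pair t \<phi> \<le> (LINT x|lborel. K * \<phi> x)"
    unfolding pair_def using K(1) \<phi>
    by (intro integral_mono_AE pair_integrable[OF t \<phi>(1)]) (auto elim!: eventually_mono intro!: mult_right_mono)
  then show ?thesis by simp
qed

text \<open>\<open>step\<close> preserves integrals because \<open>J\<close> has mass one, and the
  powers of \<open>killed\<close> lie below those of \<open>step\<close>.\<close>

lemma killed_funpow_integral_le:
  assumes \<phi>: "test B \<phi>" "\<And>x. 0 \<le> \<phi> x" "integrable lborel \<phi>"
  shows "integrable lborel ((killed ^^ k) \<phi>)" "(LINT x|lborel. (killed ^^ k) \<phi> x) \<le> (LINT x|lborel. \<phi> x)"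
proof -
  let ?g = "(killed ^^ k) \<phi>"
  have m [measurable]: "\<phi> \<in> borel_measurable borel" "?g \<in> borel_measurable borel"
    using \<phi> test_killed_funpow[of B \<phi> k] by (auto simp: test_def)
  have "(\<integral>\<^sup>+x. ennreal (?g x) \<partial>lborel) \<le> (\<integral>\<^sup>+x. (step ^^ k) (\<lambda>x. ennreal (\<phi> x)) x \<partial>lborel)"
    by (intro nn_integral_mono killed_funpow_le_step[OF \<phi>(1,2)])
  also have "\<dots> = (\<integral>\<^sup>+x. ennreal (\<phi> x) \<partial>lborel)"
    by (rule nn_integral_step_funpow) measurable
  also have "\<dots> = ennreal (LINT x|lborel. \<phi> x)"
    using \<phi> by (intro nn_integral_eq_integral) auto
  finally have *: "(\<integral>\<^sup>+x. ennreal (?g x) \<partial>lborel) \<le> ennreal (LINT x|lborel. \<phi> x)" .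
  then show i: "integrable lborel ?g"
    using killed_funpow_nonneg[OF \<phi>(2), of k]
    by (intro integrableI_bounded) (auto intro: le_less_trans)
  have "ennreal (LINT x|lborel. ?g x) \<le> ennreal (LINT x|lborel. \<phi> x)"
    using * i killed_funpow_nonneg[OF \<phi>(2), of k] by (subst nn_integral_eq_integral[symmetric]) auto
  then show "(LINT x|lborel. ?g x) \<le> (LINT x|lborel. \<phi> x)"
    using \<phi>(2) by (subst (asm) ennreal_le_iff) (auto intro!: Bochner_Integration.integral_nonneg)
qed

text \<open>Dual form of the maximum principle: the bound \<open>K\<close> at time 0 persists
  because powers of \<open>killed\<close> do not increase integrals.\<close>

lemma pair_le_sup_initial:
  assumes t: "0 \<le> t" and \<phi>: "test B \<phi>" "\<And>x. 0 \<le> \<phi> x" "integrable lborel \<phi>"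
    and K: "AE x in lborel. w 0 x \<le> K" "0 \<le> K"
  shows "pair t \<phi> \<le> K * (LINT x|lborel. \<phi> x)"
proof -
  have le: "pair 0 ((killed ^^ k) \<phi>) \<le> K * (LINT x|lborel. \<phi> x)" for k
  proof -
    have "pair 0 ((killed ^^ k) \<phi>) \<le> K * (LINT x|lborel. (killed ^^ k) \<phi> x)"
      by (rule pair_le_sup[OF _ test_killed_funpow[OF \<phi>(1)] killed_funpow_nonneg[OF \<phi>(2)]
            killed_funpow_integral_le(1)[OF \<phi>] K]) auto
    also have "\<dots> \<le> K * (LINT x|lborel. \<phi> x)"
      using K by (intro mult_left_mono killed_funpow_integral_le[OF \<phi>]) auto
    finally show ?thesis .
  qed
  show ?thesis
    using exp_series_le[OF pair_series[OF _ t \<phi>(1)] _ le] t by simp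
qed

text \<open>The term \<open>k = 0\<close>, no jump, is not smoothed and gives the exponential. For
  \<open>k \<ge> 1\<close> the function \<open>(killed ^^ k) \<phi>\<close> is at most
  \<open>C / (k + 1)\<close> times the integral of \<open>\<phi>\<close>. With
  \<open>\<tau> = t - s\<close>, the weights \<open>\<tau> ^ k / (fact k * (k + 1)) = \<tau> ^ (k +
  1) / fact (k + 1) / \<tau>\<close> sum to at most \<open>exp \<tau> / \<tau>\<close>.\<close>

lemma pair_smoothing:
  obtains C where "0 < C"
    "\<And>s t \<phi> B. 0 \<le> s \<Longrightarrow> s < t \<Longrightarrow> test B \<phi> \<Longrightarrow> (\<And>x. 0 \<le> \<phi> x) \<Longrightarrow> integrable lborel \<phi> \<Longrightarrow>
      pair t \<phi> \<le> exp (- (t - s)) * pair s \<phi> + C / (t - s) * (LINT x|lborel. w s x) * (LINT x|lborel. \<phi> x)"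
proof -
  obtain C where C: "0 < C"
    "\<And>k f x. 1 \<le> k \<Longrightarrow> f \<in> borel_measurable borel \<Longrightarrow>
      (step ^^ k) f x \<le> ennreal (C / (real k + 1)) * (\<integral>\<^sup>+y. f y \<partial>lborel)"
    using step_funpow_bound by blast
  show thesis
  proof (rule that[OF C(1)])
    fix s t B :: real and \<phi> :: "real ^ 2 \<Rightarrow> real"
    assume st: "0 \<le> s" "s < t" and \<phi>: "test B \<phi>" "\<And>x. 0 \<le> \<phi> x" "integrable lborel \<phi>"
    define M where "M = (LINT x|lborel. w s x)"
    define I where "I = (LINT x|lborel. \<phi> x)"
    define \<tau> where "\<tau> = t - s"
    have \<tau>: "\<tau> > 0" using st by (simp add: \<tau>_def)
    have I: "0 \<le> I" unfolding I_def using \<phi> by (intro Bochner_Integration.integral_nonneg) auto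
    have M: "0 \<le> M" unfolding M_def using w_nonneg[OF st(1)] by (intro integral_nonneg_AE)
    have [measurable]: "\<phi> \<in> borel_measurable borel" using \<phi>(1) by (auto simp: test_def)
    have le: "pair s ((killed ^^ k) \<phi>) \<le> C / (real k + 1) * I * M" if k: "1 \<le> k" for k
    proof -
      have "(killed ^^ k) \<phi> x \<le> C / (real k + 1) * I" for x
      proof -
        have "ennreal ((killed ^^ k) \<phi> x) \<le> (step ^^ k) (\<lambda>x. ennreal (\<phi> x)) x"
          by (rule killed_funpow_le_step[OF \<phi>(1,2)])
        also have "\<dots> \<le> ennreal (C / (real k + 1)) * (\<integral>\<^sup>+y. ennreal (\<phi> y) \<partial>lborel)"
          by (intro C(2) k) measurable
        also have "\<dots> = ennreal (C / (real k + 1) * I)"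
        proof -
          have "(\<integral>\<^sup>+y. ennreal (\<phi> y) \<partial>lborel) = ennreal I"
            unfolding I_def using \<phi> by (intro nn_integral_eq_integral) auto
          moreover have "0 \<le> C / (real k + 1)" using C by simp
          ultimately show ?thesis using I by (simp only: ennreal_mult)
        qed
        finally show ?thesis using C I by (subst (asm) ennreal_le_iff) auto
      qed
      moreover define c where "c = C / (real k + 1) * I"
      ultimately have c: "(killed ^^ k) \<phi> x \<le> c" for x by simp
      have "pair s ((killed ^^ k) \<phi>) \<le> (LINT x|lborel. w s x * c)"
        unfolding pair_def
      proof (rule integral_mono_AE[OF pair_integrable[OF st(1) test_killed_funpow[OF \<phi>(1)]]])
        show "integrable lborel (\<lambda>x. w s x * c)" using w_integrable[OF st(1)] by simp
        show "AE x in lborel. w s x * (killed ^^ k) \<phi> x \<le> w s x * c"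
          using w_nonneg[OF st(1)] by eventually_elim (intro mult_left_mono c)
      qed
      also have "\<dots> = M * c"
        unfolding M_def by (rule integral_mult_left_zero)
      finally show ?thesis by (simp add: c_def mult_ac)
    qed
    define D where "D = C / \<tau> * M * I"
    have "D \<ge> 0" using C M I \<tau> by (simp add: D_def)
    \<comment> \<open>The comparison series is the exponential series shifted by one, plus the
      unsmoothed pairing at \<open>k = 0\<close>.\<close>
    define b where "b k = \<tau> ^ Suc k / fact (Suc k) * D + (if k = 0 then pair s \<phi> else 0)" for k :: nat
    have "(\<lambda>k. \<tau> ^ k / fact k) sums exp \<tau>"
      using exp_converges[of \<tau>] by (simp add: field_simps)
    then have "(\<lambda>k. \<tau> ^ Suc k / fact (Suc k)) sums (exp \<tau> - 1)"
      by (intro iffD2[OF sums_Suc_iff[of "\<lambda>k. \<tau> ^ k / fact k"]]) simp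
    then have b: "b sums ((exp \<tau> - 1) * D + pair s \<phi>)"
      unfolding b_def by (rule sums_add[OF sums_mult2 sums_single[of 0 "\<lambda>_. pair s \<phi>"]])
    have "exp \<tau> * pair t \<phi> \<le> (exp \<tau> - 1) * D + pair s \<phi>"
    proof (rule sums_le[OF _ _ b])
      show "(\<lambda>k. \<tau> ^ k / fact k * pair s ((killed ^^ k) \<phi>)) sums (exp \<tau> * pair t \<phi>)"
        unfolding \<tau>_def using pair_series[OF st(1) _ \<phi>(1), of t] st by simp
      show "\<tau> ^ k / fact k * pair s ((killed ^^ k) \<phi>) \<le> b k" for k
      proof (cases "k = 0")
        case True
        then show ?thesis using \<open>D \<ge> 0\<close> \<tau> by (simp add: b_def)
      next
        case False
        then have "\<tau> ^ k / fact k * pair s ((killed ^^ k) \<phi>) \<le> \<tau> ^ k / fact k * (C / (real k + 1) * I * M)"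
          using \<tau> by (intro mult_left_mono le) auto
        also have "\<dots> = \<tau> ^ Suc k / fact (Suc k) * D"
        proof -
          have "\<tau> ^ Suc k / fact (Suc k) = \<tau> ^ k / fact k * (\<tau> / (real k + 1))"
            unfolding fact_Suc power_Suc by (simp add: mult_ac add.commute)
          then show ?thesis unfolding D_def using \<tau> by simp
        qed
        finally show ?thesis using False by (simp add: b_def)
      qed
    qed
    also have "\<dots> \<le> exp \<tau> * D + pair s \<phi>"
      using \<open>D \<ge> 0\<close> by (simp add: algebra_simps)
    finally have "exp (- \<tau>) * (exp \<tau> * pair t \<phi>) \<le> exp (- \<tau>) * (exp \<tau> * D + pair s \<phi>)"
      by (rule mult_left_mono) simp
    then have "pair t \<phi> \<le> D + exp (- \<tau>) * pair s \<phi>"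
      by (simp add: distrib_left mult.assoc[symmetric] exp_add[symmetric])
    then show "pair t \<phi> \<le> exp (- (t - s)) * pair s \<phi> + C / (t - s) * (LINT x|lborel. w s x) * (LINT x|lborel. \<phi> x)"
      by (simp add: D_def M_def I_def \<tau>_def)
  qed
qed

end

section \<open>A superharmonic weight of logarithmic growth\<close>

text \<open>The preimage of a box is its image under the inverse map, and orthogonal images preserve
  volume.\<close>

lemma distr_lborel_orthogonal:
  fixes f :: "real ^ 'n::{finite,wellorder} \<Rightarrow> real ^ 'n::_"
  assumes f: "orthogonal_transformation f"
  shows "distr lborel borel f = lborel"
proof (rule lborel_eqI[symmetric])
  fix l u :: "real ^ 'n::_" assume lu: "\<And>b. b \<in> Basis \<Longrightarrow> l \<bullet> b \<le> u \<bullet> b"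
  have f_meas [measurable]: "f \<in> borel_measurable borel"
    using f by (intro borel_measurable_continuous_onI linear_continuous_on)
      (simp add: linear_conv_bounded_linear[symmetric] orthogonal_transformation_linear)
  have g: "orthogonal_transformation (inv f)" by (rule orthogonal_transformation_inv[OF f])
  have "f -` box l u = inv f ` box l u"
    by (rule bij_vimage_eq_inv_image[OF orthogonal_transformation_bij[OF f]])
  then have S: "inv f ` box l u \<in> sets borel"
    using measurable_sets[OF f_meas, of "box l u"] by simp
  have "emeasure (distr lborel borel f) (box l u) = emeasure lborel (inv f ` box l u)"
    using \<open>f -` box l u = inv f ` box l u\<close> by (subst emeasure_distr) auto
  also have "\<dots> = emeasure lebesgue (inv f ` box l u)"
    using S by simp
  also have "\<dots> = ennreal (measure lebesgue (inv f ` box l u))"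
    using measurable_orthogonal_image[OF g, of "box l u"] by (intro emeasure_eq_measure2) auto
  also have "\<dots> = ennreal (measure lborel (box l u))"
    by (simp add: measure_orthogonal_image[OF g])
  also have "\<dots> = (\<Prod>b\<in>Basis. (u - l) \<bullet> b)"
    using lu by (simp add: emeasure_eq_ennreal_measure[symmetric] emeasure_lborel_box)
  finally show "emeasure (distr lborel borel f) (box l u) = (\<Prod>b\<in>Basis. (u - l) \<bullet> b)" .
qed simp

text \<open>Complex structure on the plane, for the powers and roots of unity behind the mean value
  inequality.\<close>

definition to_complex :: "real ^ 2 \<Rightarrow> complex" where
  "to_complex y = Complex (y $ 1) (y $ 2)"

definition rotate_by :: "complex \<Rightarrow> real ^ 2 \<Rightarrow> real ^ 2" where
  "rotate_by \<omega> y = vector [Re (\<omega> * to_complex y), Im (\<omega> * to_complex y)]"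

lemma to_complex_rotate_by [simp]: "to_complex (rotate_by \<omega> y) = \<omega> * to_complex y"
  by (simp add: rotate_by_def to_complex_def vector_2 complex_eq_iff)

lemma norm_to_complex [simp]: "cmod (to_complex y) = norm y"
  by (simp add: to_complex_def cmod_def norm_vec_def L2_set_def sum_2)

lemma to_complex_add: "to_complex (x + y) = to_complex x + to_complex y"
  by (simp add: to_complex_def complex_eq_iff)

lemma measurable_to_complex [measurable]: "to_complex \<in> borel_measurable borel"
proof -
  have *: "to_complex = (\<lambda>y. of_real (y $ 1) + \<i> * of_real (y $ 2))"
    by (auto simp: to_complex_def complex_eq_iff)
  show ?thesis unfolding * by (intro borel_measurable_continuous_onI continuous_intros)
qed

lemma orthogonal_rotate_by:
  assumes "cmod \<omega> = 1"
  shows "orthogonal_transformation (rotate_by \<omega>)"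
proof -
  have "linear (rotate_by \<omega>)"
    by (rule linearI) (auto simp: rotate_by_def to_complex_def vec_eq_iff forall_2 vector_2 algebra_simps)
  moreover have "norm (rotate_by \<omega> y) = norm y" for y
    using assms by (simp flip: norm_to_complex add: norm_mult)
  ultimately show ?thesis
    by (simp add: orthogonal_transformation)
qed

section \<open>Mean value inequality for the logarithm, and the weight built from it\<close>

locale radial_exterior_kernel = exterior_kernel +
  assumes J_radial: "norm x = norm y \<Longrightarrow> J x = J y"
    and disc_subset: "ball 0 2 \<subseteq> H"
begin

lemma norm_outside: "x \<notin> H \<Longrightarrow> 2 \<le> norm x"
  using disc_subset by (auto simp: subset_iff not_less[symmetric])

text \<open>For \<open>norm y < norm x\<close> and \<open>N > 0\<close> this is the sum of
  \<open>ln (cmod (x + \<omega> * y))\<close> over the \<open>N\<close>-th roots of unity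
  \<open>\<omega>\<close>, with \<open>x\<close> and \<open>y\<close> read as complex numbers;
  \<open>N = 1\<close> gives \<open>ln (norm (x + y))\<close>.\<close>

definition log_pot :: "real ^ 2 \<Rightarrow> nat \<Rightarrow> real ^ 2 \<Rightarrow> real" where
  "log_pot x N y = ln (cmod (to_complex x ^ N - (- to_complex y) ^ N))"

lemma log_pot_pos:
  assumes "norm y < norm x" "0 < N"
  shows "0 < cmod (to_complex x ^ N - (- to_complex y) ^ N)"
    and "norm x ^ N - norm y ^ N \<le> cmod (to_complex x ^ N - (- to_complex y) ^ N)"
    and "cmod (to_complex x ^ N - (- to_complex y) ^ N) \<le> norm x ^ N + norm y ^ N"
proof -
  have n: "cmod ((- to_complex y) ^ N) = norm y ^ N" "cmod (to_complex x ^ N) = norm x ^ N"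
    by (simp_all add: norm_power)
  show 1: "norm x ^ N - norm y ^ N \<le> cmod (to_complex x ^ N - (- to_complex y) ^ N)"
    using norm_triangle_ineq2[of "to_complex x ^ N" "(- to_complex y) ^ N"] n by simp
  show "cmod (to_complex x ^ N - (- to_complex y) ^ N) \<le> norm x ^ N + norm y ^ N"
    using norm_triangle_ineq4[of "to_complex x ^ N" "(- to_complex y) ^ N"] n by simp
  have "norm y ^ N < norm x ^ N" using assms by (intro power_strict_mono) auto
  with 1 show "0 < cmod (to_complex x ^ N - (- to_complex y) ^ N)" by linarith
qed

lemma log_pot_measurable [measurable]: "log_pot x N \<in> borel_measurable borel"
  unfolding log_pot_def[abs_def] by measurable

lemma log_pot_integrable:
  assumes x: "d < norm x" and N: "0 < N"
  shows "integrable lborel (\<lambda>y. J y * log_pot x N y)"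
proof (rule Bochner_Integration.integrable_bound)
  define lo where "lo = norm x ^ N - d ^ N"
  define hi where "hi = norm x ^ N + d ^ N"
  define B where "B = \<bar>ln lo\<bar> + \<bar>ln hi\<bar>"
  have lo: "0 < lo" using x N d_pos unfolding lo_def by (simp add: power_strict_mono)
  show "integrable lborel (\<lambda>y. J y * B)" by simp
  show "AE y in lborel. norm (J y * log_pot x N y) \<le> norm (J y * B)"
  proof (intro AE_I2)
    fix y
    show "norm (J y * log_pot x N y) \<le> norm (J y * B)"
    proof (cases "norm y < d")
      case True
      then have yx: "norm y < norm x" using x by simp
      have "norm y ^ N \<le> d ^ N" using True by (intro power_mono) auto
      with log_pot_pos[OF yx N] have "lo \<le> cmod (to_complex x ^ N - (- to_complex y) ^ N)"
        "cmod (to_complex x ^ N - (- to_complex y) ^ N) \<le> hi"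
        by (auto simp: lo_def hi_def)
      then have "ln lo \<le> log_pot x N y" "log_pot x N y \<le> ln hi"
        using lo unfolding log_pot_def by (auto intro!: ln_mono log_pot_pos(1)[OF yx N])
      then have "\<bar>log_pot x N y\<bar> \<le> \<bar>B\<bar>" unfolding B_def by linarith
      then show ?thesis using J_nonneg[of y] by (simp add: abs_mult mult_left_mono)
    qed (simp add: J_zero)
  qed
qed measurable

text \<open>Doubling \<open>N\<close> averages \<open>ln \<bar>x\<^sup>N - (-y)\<^sup>N\<bar>\<close> over a rotation of \<open>y\<close> by an \<open>N\<close>-th root of \<open>-1\<close>, which
  the radial weight \<open>J\<close> does not notice.\<close>

lemma log_pot_double:
  assumes x: "d < norm x" and N: "0 < N"
  shows "(LINT y|lborel. J y * log_pot x (2 * N) y) = 2 * (LINT y|lborel. J y * log_pot x N y)"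
proof -
  define \<omega> where "\<omega> = cis (pi / N)"
  have \<omega>: "\<omega> ^ N = -1" "cmod \<omega> = 1"
    using N Complex.DeMoivre[of "pi / N" N] by (simp_all add: \<omega>_def)
  let ?r = "rotate_by \<omega>"
  note orth = orthogonal_rotate_by[OF \<omega>(2)]
  have r_meas [measurable]: "?r \<in> borel_measurable borel"
    using orth by (intro borel_measurable_continuous_onI linear_continuous_on)
      (simp add: linear_conv_bounded_linear[symmetric] orthogonal_transformation_linear)
  have Jr: "J (?r y) = J y" for y
    by (rule J_radial) (rule orthogonal_transformation_norm[OF orth])
  have i: "integrable lborel (\<lambda>y. J y * log_pot x N (?r y))"
    and e: "(LINT y|lborel. J y * log_pot x N (?r y)) = (LINT y|lborel. J y * log_pot x N y)"
  proof -
    have "integrable (distr lborel borel ?r) (\<lambda>y. J y * log_pot x N y)"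
      by (simp only: distr_lborel_orthogonal[OF orth] log_pot_integrable[OF x N])
    then show "integrable lborel (\<lambda>y. J y * log_pot x N (?r y))"
      by (subst (asm) integrable_distr_eq) (auto simp: Jr)
    have "(LINT y|distr lborel borel ?r. J y * log_pot x N y) = (LINT y|lborel. J y * log_pot x N (?r y))"
      by (subst integral_distr) (auto simp: Jr)
    then show "(LINT y|lborel. J y * log_pot x N (?r y)) = (LINT y|lborel. J y * log_pot x N y)"
      by (simp only: distr_lborel_orthogonal[OF orth])
  qed
  have "J y * log_pot x (2 * N) y = J y * log_pot x N y + J y * log_pot x N (?r y)" for y
  proof (cases "norm y < d")
    case True
    then have yx: "norm y < norm x" using x by simp
    have ryx: "norm (?r y) < norm x" using yx orthogonal_transformation_norm[OF orth, of y] by simp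
    let ?a = "to_complex x ^ N" and ?b = "(- to_complex y) ^ N"
    \<comment> \<open>Since \<open>\<omega> ^ N = -1\<close>, rotating \<open>y\<close> flips the
      sign of its \<open>N\<close>-th power, so the two potentials belong to the two factors of a
      difference of squares.\<close>
    have rb: "(- to_complex (?r y)) ^ N = - ?b"
    proof -
      have "(- to_complex (?r y)) ^ N = \<omega> ^ N * ?b"
        by (simp flip: power_mult_distrib)
      then show ?thesis using \<omega> by simp
    qed
    have "to_complex x ^ (2 * N) - (- to_complex y) ^ (2 * N) = (?a - ?b) * (?a + ?b)"
      unfolding mult.commute[of 2 N] power_mult by (simp add: power2_eq_square algebra_simps)
    then have "log_pot x (2 * N) y = ln (cmod (?a - ?b) * cmod (?a + ?b))"
      by (simp add: log_pot_def norm_mult)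
    also have "\<dots> = ln (cmod (?a - ?b)) + ln (cmod (?a + ?b))"
      using log_pot_pos(1)[OF yx N] log_pot_pos(1)[OF ryx N] unfolding rb by (intro ln_mult_pos) auto
    finally have "log_pot x (2 * N) y = log_pot x N y + log_pot x N (?r y)"
      unfolding log_pot_def rb by simp
    then show ?thesis by (simp add: distrib_left)
  qed (simp add: J_zero)
  then show ?thesis
    using i e log_pot_integrable[OF x N] by simp
qed

text \<open>By \<open>log_pot_double\<close>, \<open>2 ^ m\<close> times the mean is the mean of
  \<open>log_pot x (2 ^ m)\<close>. This is at most \<open>2 ^ m * ln (norm x) + ln 2\<close>, since
  the modulus is at most \<open>2 * norm x ^ N\<close>. Dividing by \<open>2 ^ m\<close> removes the
  error in the limit.\<close>

lemma log_mean_le: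
  assumes x: "d < norm x"
  shows "(LINT y|lborel. J y * ln (norm (x + y))) \<le> ln (norm x)"
proof -
  define L where "L = (LINT y|lborel. J y * log_pot x 1 y)"
  have pow: "(LINT y|lborel. J y * log_pot x (2 ^ m) y) = 2 ^ m * L" for m
    by (induction m) (simp_all add: L_def log_pot_double[OF x])
  have "L \<le> ln (norm x) + ln 2 * (1/2) ^ m" for m
  proof -
    define N :: nat where "N = 2 ^ m"
    have N: "0 < N" by (simp add: N_def)
    have "(LINT y|lborel. J y * log_pot x N y) \<le> (LINT y|lborel. J y * (N * ln (norm x) + ln 2))"
    proof (rule integral_mono[OF log_pot_integrable[OF x N]])
      fix y
      show "J y * log_pot x N y \<le> J y * (N * ln (norm x) + ln 2)"
      proof (cases "norm y < d")
        case True
        then have yx: "norm y < norm x" using x by simp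
        have x0: "0 < norm x" using x d_pos by linarith
        have "norm y ^ N \<le> norm x ^ N" using yx by (intro power_mono) auto
        then have "cmod (to_complex x ^ N - (- to_complex y) ^ N) \<le> norm x ^ N * 2"
          using log_pot_pos(3)[OF yx N] by linarith
        then have "log_pot x N y \<le> ln (norm x ^ N * 2)"
          unfolding log_pot_def by (intro ln_mono log_pot_pos(1)[OF yx N])
        also have "\<dots> = N * ln (norm x) + ln 2"
          using x0 by (subst ln_mult_pos) (auto simp: ln_realpow)
        finally show ?thesis by (intro mult_left_mono J_nonneg)
      qed (simp add: J_zero)
    qed simp
    also have "\<dots> = N * ln (norm x) + ln 2" by (simp add: J_int)
    also have "\<dots> = 2 ^ m * (ln (norm x) + ln 2 * (1/2) ^ m)"
      by (simp add: N_def distrib_left power_one_over)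
    finally have "2 ^ m * L \<le> 2 ^ m * (ln (norm x) + ln 2 * (1/2) ^ m)"
      by (simp only: N_def pow)
    then show ?thesis by simp
  qed
  moreover have "(\<lambda>m. ln (norm x) + ln 2 * (1/2) ^ m) \<longlonglongrightarrow> ln (norm x) + ln 2 * 0"
    by (intro tendsto_intros LIMSEQ_power_zero) simp
  ultimately have "L \<le> ln (norm x) + ln 2 * 0"
    by (intro LIMSEQ_le_const) auto
  moreover have "L = (LINT y|lborel. J y * ln (norm (x + y)))"
    by (simp add: L_def log_pot_def flip: to_complex_add)
  ultimately show ?thesis by simp
qed

text \<open>The hole contains a whole disc, so jumps of length at most \<open>d - 1 / 4\<close>,
  where \<open>J\<close> is bounded below, still reach a small ball inside it.\<close>

lemma absorption_near_hole:
  obtains c where "0 < c" "c \<le> 1"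
    "\<And>x. x \<notin> H \<Longrightarrow> norm x < d + 1 \<Longrightarrow> c \<le> avg (indicator H) x"
proof -
  obtain m where m: "0 < m" "\<And>x. norm x \<le> d - 1 / 4 \<Longrightarrow> m \<le> J x"
    using J_bounded_below[of "d - 1 / 4"] by auto
  define v where "v = measure lborel (ball (0 :: real ^ 2) (1 / 4))"
  have v: "0 < v" by (simp add: v_def content_ball unit_ball_vol_pos)
  show thesis
  proof (rule that[of "min 1 (m * v)"])
    fix x assume x: "x \<notin> H" "norm x < d + 1"
    have x2: "2 \<le> norm x" by (rule norm_outside[OF x(1)])
    \<comment> \<open>The target is the point at radius 3/2 in the direction of \<open>x\<close>.
      The ball of radius 1/4 around it lies in the disc, and its points are close enough to
      \<open>x\<close> because \<open>norm x - 3 / 2 + 1 / 4 < d - 1 / 4\<close>.\<close>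
    define y where "y = (3 / (2 * norm x)) *\<^sub>R x"
    have y: "norm y = 3 / 2" "norm (y - x) = norm x - 3 / 2"
    proof -
      have "x \<noteq> 0" using x2 by auto
      show "norm y = 3 / 2" using \<open>x \<noteq> 0\<close> by (simp add: y_def)
      have "y - x = (3 / (2 * norm x) - 1) *\<^sub>R x" by (simp add: y_def scaleR_diff_left)
      then have "norm (y - x) = \<bar>3 / (2 * norm x) - 1\<bar> * norm x" by simp
      also have "\<bar>3 / (2 * norm x) - 1\<bar> = 1 - 3 / (2 * norm x)"
      proof -
        have "0 < norm x" using x2 by linarith
        then have "3 / (2 * norm x) \<le> 1" using x2 by (simp add: field_simps)
        then show ?thesis by linarith
      qed
      also have "\<dots> * norm x = norm x - 3 / 2" using \<open>x \<noteq> 0\<close> by (simp add: field_simps)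
      finally show "norm (y - x) = norm x - 3 / 2" .
    qed
    let ?B = "ball (y - x) (1 / 4)"
    have "m * v = (LINT z|lborel. m * indicator ?B z)"
      by (simp add: v_def content_ball)
    also have "\<dots> \<le> (LINT z|lborel. J z * indicator H (x + z))"
    proof (rule integral_mono)
      show "integrable lborel (\<lambda>z. m * indicator ?B z)"
        by (intro integrable_mult_right integrable_real_indicator emeasure_lborel_ball_finite) auto
      show "integrable lborel (\<lambda>z. J z * indicator H (x + z))"
        by (rule avg_integrable[where B = 1]) (auto simp: indicator_def)
      fix z
      show "m * indicator ?B z \<le> J z * indicator H (x + z)"
      proof (cases "z \<in> ?B")
        case True
        then have z: "norm (z - (y - x)) < 1 / 4" by (simp add: dist_norm norm_minus_commute)
        have "norm z \<le> norm (y - x) + norm (z - (y - x))" using norm_triangle_sub by blast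
        then have "norm z \<le> d - 1 / 4" using z y x by linarith
        moreover have "norm (x + z) \<le> norm y + norm (x + z - y)" using norm_triangle_sub by blast
        then have "norm (x + z) < 2" using z y by (simp add: algebra_simps)
        then have "x + z \<in> H" using disc_subset by auto
        ultimately show ?thesis using m(2)[of z] True by simp
      qed (simp add: J_nonneg)
    qed
    also have "\<dots> = avg (indicator H) x" by (simp add: avg_def)
    finally show "min 1 (m * v) \<le> avg (indicator H) x" by simp
  qed (use m v in auto)
qed

text \<open>The cut at \<open>n\<close> makes the weight bounded, hence a test function; the shift
  \<open>A\<close> makes killing near the hole outweigh the growth of the logarithm.\<close>

definition log_weight :: "real \<Rightarrow> real \<Rightarrow> real ^ 2 \<Rightarrow> real" where
  "log_weight A n x = indicator (- H) x * min (ln (norm x) + A) n"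

lemma log_weight_bounds:
  assumes "0 \<le> A" "0 \<le> n"
  shows "0 \<le> log_weight A n x" "log_weight A n x \<le> n"
    and "log_weight A n x \<le> indicator (- H) x * (ln (norm x) + A)"
  using norm_outside[of x] assms by (auto simp: log_weight_def indicator_def)

lemma test_log_weight:
  assumes "0 \<le> A" "0 \<le> n"
  shows "test n (log_weight A n)"
proof -
  have "log_weight A n \<in> borel_measurable borel"
    unfolding log_weight_def[abs_def] by measurable
  then show ?thesis
    using log_weight_bounds[OF assms] by (auto simp: test_def log_weight_def)
qed

text \<open>Outside the hole the weight is a minimum, so its average is bounded separately by
  \<open>n\<close> and by \<open>ln (norm x) + A\<close>.\<close>

lemma log_weight_superharmonic:
  obtains A where "0 \<le> A" "\<And>n x. 0 \<le> n \<Longrightarrow> killed (log_weight A n) x \<le> log_weight A n x"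
proof -
  obtain c where c: "0 < c" "c \<le> 1"
    "\<And>x. x \<notin> H \<Longrightarrow> norm x < d + 1 \<Longrightarrow> c \<le> avg (indicator H) x"
    using absorption_near_hole by blast
  \<comment> \<open>From \<open>norm x < d + 1\<close> a single jump reaches norm at most
    \<open>2 * d + 1\<close>.\<close>
  define L where "L = ln (2 * d + 1)"
  have L: "0 \<le> L" using d_pos by (simp add: L_def)
  \<comment> \<open>As \<open>A * c = L\<close>, survival with probability at most
    \<open>1 - c\<close> gives \<open>(L + A) * (1 - c) = A - L * c \<le> A\<close>.\<close>
  define A where "A = L / c"
  have A: "0 \<le> A" using L c by (simp add: A_def)
  have "killed (log_weight A n) x \<le> log_weight A n x" if n: "0 \<le> n" for n x
  proof (cases "x \<in> H")
    case True
    then show ?thesis by (simp add: killed_def log_weight_def)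
  next
    case False
    let ?w = "log_weight A n"
    note b = log_weight_bounds[OF A n]
    have x2: "2 \<le> norm x" by (rule norm_outside[OF False])
    have wt: "?w \<in> borel_measurable borel" "\<And>x. \<bar>?w x\<bar> \<le> n"
      using test_log_weight[OF A n] by (auto simp: test_def)
    have "avg ?w x \<le> n" using avg_bound[OF wt, of x] by simp
    moreover have "avg ?w x \<le> ln (norm x) + A"
    proof (cases "norm x < d + 1")
      case True
      have i: "integrable lborel (\<lambda>y. J y * indicator H (x + y))"
        by (rule avg_integrable[where B = 1]) (auto simp: indicator_def)
      have "avg ?w x \<le> (LINT y|lborel. (L + A) * (J y - J y * indicator H (x + y)))"
        unfolding avg_def
      proof (rule integral_mono[OF avg_integrable[OF wt]])
        show "integrable lborel (\<lambda>y. (L + A) * (J y - J y * indicator H (x + y)))"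
          using i by simp
        fix y
        show "J y * ?w (x + y) \<le> (L + A) * (J y - J y * indicator H (x + y))"
        proof (cases "norm y < d \<and> x + y \<notin> H")
          case y: True
          have "norm (x + y) \<le> 2 * d + 1" using norm_triangle_ineq[of x y] y True by linarith
          then have "ln (norm (x + y)) \<le> L"
            using norm_outside[of "x + y"] y unfolding L_def by (intro ln_mono) auto
          then have "?w (x + y) \<le> L + A" using b(3)[of "x + y"] y by simp
          then have "J y * ?w (x + y) \<le> J y * (L + A)" by (intro mult_left_mono J_nonneg)
          then show ?thesis using y by (simp add: mult.commute)
        qed (auto simp: J_zero log_weight_def)
      qed
      also have "\<dots> = (L + A) * (1 - avg (indicator H) x)"
        using i by (simp add: avg_def J_int)
      also have "\<dots> \<le> (L + A) * (1 - c)"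
        using c(3)[OF False True] L A by (intro mult_left_mono) auto
      also have "\<dots> = A - L * c" using c by (simp add: A_def field_simps)
      also have "\<dots> \<le> ln (norm x) + A"
      proof -
        have "0 \<le> L * c" "0 \<le> ln (norm x)" using L c x2 by auto
        then show ?thesis by linarith
      qed
      finally show ?thesis .
    next
      \<comment> \<open>Now \<open>1 \<le> norm (x + y)\<close> for every possible jump, so
        \<open>ln (norm (x + y)) + A\<close> is nonnegative and dominates the weight in the hole
        too.\<close>
      case big: False
      have i: "integrable lborel (\<lambda>y. J y * ln (norm (x + y)))"
        using log_pot_integrable[of x 1] big by (simp add: log_pot_def flip: to_complex_add)
      have "avg ?w x \<le> (LINT y|lborel. J y * ln (norm (x + y)) + J y * A)"
        unfolding avg_def
      proof (rule integral_mono[OF avg_integrable[OF wt]])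
        show "integrable lborel (\<lambda>y. J y * ln (norm (x + y)) + J y * A)"
          using i by simp
        fix y
        show "J y * ?w (x + y) \<le> J y * ln (norm (x + y)) + J y * A"
        proof (cases "norm y < d")
          case True
          have "norm x \<le> norm (x + y) + norm y" using norm_triangle_ineq4[of "x + y" y] by simp
          then have "1 \<le> norm (x + y)" using big True by linarith
          then have "?w (x + y) \<le> ln (norm (x + y)) + A"
          proof -
            have "indicator (- H) (x + y) * (ln (norm (x + y)) + A) \<le> 1 * (ln (norm (x + y)) + A)"
              using A \<open>1 \<le> norm (x + y)\<close> by (intro mult_right_mono add_nonneg_nonneg ln_ge_zero) (auto simp: indicator_def)
            from order_trans[OF b(3) this] show ?thesis by simp
          qed
          then have "J y * ?w (x + y) \<le> J y * (ln (norm (x + y)) + A)" by (intro mult_left_mono J_nonneg)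
          then show ?thesis by (simp add: distrib_left)
        qed (simp add: J_zero)
      qed
      also have "\<dots> = (LINT y|lborel. J y * ln (norm (x + y))) + A"
        using i by (simp add: J_int)
      also have "\<dots> \<le> ln (norm x) + A" using log_mean_le[of x] big by simp
      finally show ?thesis .
    qed
    ultimately show ?thesis using False by (simp add: killed_def log_weight_def)
  qed
  with A show thesis by (rule that)
qed

end

section \<open>Decay of the mass\<close>

text \<open>\<open>max B (2 * Q)\<close> is stable under halving and adding \<open>Q\<close>; dyadic
  induction starts from the times between \<open>T / 2\<close> and \<open>T\<close>.\<close>

lemma halving_bound:
  fixes N :: "real \<Rightarrow> real"
  assumes T: "0 < T" and step: "\<And>t. T \<le> t \<Longrightarrow> N t \<le> N (t / 2) / 2 + Q"
    and base: "\<And>t. T / 2 \<le> t \<Longrightarrow> t \<le> T \<Longrightarrow> N t \<le> B"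
    and t: "T / 2 \<le> t"
  shows "N t \<le> max B (2 * Q)"
proof -
  have "N t \<le> max B (2 * Q)" if "T / 2 \<le> t" "t \<le> 2 ^ n * T" for n :: nat and t
    using that
  proof (induction n arbitrary: t)
    case (Suc n)
    show ?case
    proof (cases "t \<le> T")
      case False
      then have "N (t / 2) \<le> max B (2 * Q)" using Suc by (intro Suc.IH) auto
      then show ?thesis using step[of t] False by linarith
    qed (use base[of t] Suc in auto)
  qed (use base in fastforce)
  moreover obtain n :: nat where "t / T < 2 ^ n" using real_arch_pow[of 2 "t / T"] by auto
  then have "t \<le> 2 ^ n * T" using T by (simp add: field_simps)
  ultimately show ?thesis using t by blast
qed

text \<open>Quadratic decay of the unsmoothed part is enough, since it beats
  \<open>1 / (t * ln t)\<close>.\<close>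

lemma exp_minus_half_le: 
  fixes t :: real
  assumes "0 < t"
  shows "exp (- (t / 2)) \<le> 8 / t\<^sup>2"
proof -
  have "t\<^sup>2 / 8 \<le> exp (t / 2)"
    using exp_lower_Taylor_quadratic[of "t / 2"] assms by (simp add: power2_eq_square)
  then show ?thesis using assms by (simp add: exp_minus field_simps)
qed

text \<open>From \<open>t = 4\<close> on, \<open>ln 2\<close> is at most half of
  \<open>ln t\<close>.\<close>

lemma ln_le_twice_ln_half:
  fixes t :: real
  assumes "4 \<le> t"
  shows "ln t \<le> 2 * ln (t / 2)"
proof -
  have "ln 4 \<le> ln t" using assms by (intro ln_mono) auto
  moreover have "ln 4 = 2 * ln (2::real)" using ln_realpow[of 2 2] by simp
  moreover have "ln (t / 2) = ln t - ln 2" using assms by (simp add: ln_div)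
  ultimately show ?thesis by simp
qed

locale radial_exterior_solution = radial_exterior_kernel + nonneg_exterior_solution +
  fixes K :: real
  assumes K_pos: "0 < K"
    and w0_le: "AE x in lborel. w 0 x \<le> K"
    and w0_log: "integrable lborel (\<lambda>x. w 0 x * ln (norm x))"
begin

definition mass :: "real \<Rightarrow> real" where
  "mass t = (LINT x|lborel. w t x)"

lemma mass_nonneg: "0 \<le> t \<Longrightarrow> 0 \<le> mass t"
  unfolding mass_def using w_nonneg[of t] by (intro integral_nonneg_AE)

text \<open>The mass is the pairing with the indicator of \<open>- H\<close>, which is superharmonic
  for \<open>killed\<close>.\<close>

lemma mass_antimono:
  assumes "0 \<le> s" "s \<le> t"
  shows "mass t \<le> mass s"
proof -
  have m: "mass r = pair r (indicator (- H))" if "0 \<le> r" for r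
    unfolding mass_def pair_def using w_zero[OF that] w_measurable[OF that]
    by (intro integral_cong_AE) (auto simp: indicator_def elim!: eventually_mono)
  have "avg (indicator (- H)) x \<le> 1" for x
    using avg_bound[of "indicator (- H)" 1 x] by (auto simp: indicator_def)
  then have *: "killed (indicator (- H)) x \<le> indicator (- H) x" for x
    by (auto simp: killed_def indicator_def)
  have "pair t (indicator (- H)) \<le> pair s (indicator (- H))"
  proof (rule pair_superharmonic_le[OF assms _ *])
    show "test 1 (indicator (- H))" by (rule test_indicator) auto
  qed
  then show ?thesis using assms by (simp add: m)
qed

text \<open>Smoothing over the second half of the time interval; in the exponential term the sup at
  \<open>t / 2\<close> is controlled by the initial bound \<open>K\<close>.\<close>

lemma sup_bound:
  obtains C where "0 < C"
    "\<And>t. 0 < t \<Longrightarrow> AE x in lborel. w t x \<le> exp (- (t / 2)) * K + C / t * mass (t / 2)"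
proof -
  obtain C where C: "0 < C"
    "\<And>s t \<phi> B. 0 \<le> s \<Longrightarrow> s < t \<Longrightarrow> test B \<phi> \<Longrightarrow> (\<And>x. 0 \<le> \<phi> x) \<Longrightarrow> integrable lborel \<phi> \<Longrightarrow>
      pair t \<phi> \<le> exp (- (t - s)) * pair s \<phi> + C / (t - s) * (LINT x|lborel. w s x) * (LINT x|lborel. \<phi> x)"
    using pair_smoothing by blast
  show thesis
  \<comment> \<open>The factor 2 comes from \<open>t - t / 2 = t / 2\<close>.\<close>
  proof (rule that[of "2 * C"])
    fix t :: real assume t: "0 < t"
    then have t2: "0 \<le> t / 2" "t / 2 < t" "0 \<le> t" by auto
    show "AE x in lborel. w t x \<le> exp (- (t / 2)) * K + 2 * C / t * mass (t / 2)"
    proof (rule w_le[OF t2(3)])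
      show "0 < exp (- (t / 2)) * K + 2 * C / t * mass (t / 2)"
        using K_pos C(1) t mass_nonneg[OF t2(1)] by (intro add_pos_nonneg) auto
      fix \<phi> assume \<phi>: "test 1 \<phi>" "\<And>x. 0 \<le> \<phi> x" "integrable lborel \<phi>"
      have "pair t \<phi> \<le> exp (- (t - t / 2)) * pair (t / 2) \<phi> + C / (t - t / 2) * mass (t / 2) * (LINT x|lborel. \<phi> x)"
        unfolding mass_def by (rule C(2)[OF t2(1,2) \<phi>])
      also have "\<dots> = exp (- (t / 2)) * pair (t / 2) \<phi> + 2 * C / t * mass (t / 2) * (LINT x|lborel. \<phi> x)"
        by simp
      also have "\<dots> \<le> exp (- (t / 2)) * (K * (LINT x|lborel. \<phi> x)) + 2 * C / t * mass (t / 2) * (LINT x|lborel. \<phi> x)"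
        using K_pos by (intro add_right_mono mult_left_mono pair_le_sup_initial[OF t2(1) \<phi> w0_le]) auto
      finally show "pair t \<phi> \<le> (exp (- (t / 2)) * K + 2 * C / t * mass (t / 2)) * (LINT x|lborel. \<phi> x)"
        by (simp add: distrib_right mult.assoc)
    qed
  qed (use C in simp)
qed

text \<open>\<open>\<phi>\<close> is the weight cut at the level \<open>ln \<rho>\<close>. The bound
  depends on neither \<open>\<rho>\<close> nor \<open>t\<close>: it is the untruncated logarithmic
  moment of the datum plus a constant times its mass.\<close>

lemma log_moment_bound:
  obtains L where "0 \<le> L" "\<And>\<rho> t. 1 < \<rho> \<Longrightarrow> 0 \<le> t \<Longrightarrow>
      \<exists>\<phi>. test (ln \<rho>) \<phi> \<and> (\<forall>x. 0 \<le> \<phi> x) \<and> (\<forall>x. x \<notin> H \<longrightarrow> \<rho> \<le> norm x \<longrightarrow> ln \<rho> \<le> \<phi> x) \<and> pair t \<phi> \<le> L"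
proof -
  obtain A where A: "0 \<le> A" "\<And>n x. 0 \<le> n \<Longrightarrow> killed (log_weight A n) x \<le> log_weight A n x"
    using log_weight_superharmonic by blast
  define L where "L = (LINT x|lborel. w 0 x * ln (norm x) + w 0 x * A)"
  have L: "pair t (log_weight A n) \<le> L" if "0 \<le> n" "0 \<le> t" for n t
  proof -
    note T = test_log_weight[OF A(1) that(1)]
    have "pair t (log_weight A n) \<le> pair 0 (log_weight A n)"
      using that by (intro pair_superharmonic_le[OF _ _ T A(2)]) auto
    also have "\<dots> \<le> L"
      unfolding pair_def L_def
    proof (rule integral_mono_AE[OF pair_integrable[OF _ T]])
      show "integrable lborel (\<lambda>x. w 0 x * ln (norm x) + w 0 x * A)"
        using w0_log w_integrable[of 0] by simp
      show "AE x in lborel. w 0 x * log_weight A n x \<le> w 0 x * ln (norm x) + w 0 x * A"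
        using w0_nonneg w_zero[OF order_refl]
      proof eventually_elim
        case (elim x)
        then show ?case
          using mult_left_mono[OF log_weight_bounds(3)[OF A(1) that(1), of x], of "w 0 x"]
          by (cases "x \<in> H") (auto simp: distrib_left)
      qed
    qed simp
    finally show ?thesis .
  qed
  show thesis
  proof (rule that)
    show "0 \<le> L"
    proof (rule order_trans[OF _ L[of 0 0]])
      show "0 \<le> pair 0 (log_weight A 0)"
        by (rule pair_nonneg[OF _ test_log_weight[OF A(1)] log_weight_bounds(1)[OF A(1)]]) auto
    qed auto
    fix \<rho> t :: real assume \<rho>: "1 < \<rho>" and t: "0 \<le> t"
    then have n: "0 \<le> ln \<rho>" by simp
    have "ln \<rho> \<le> log_weight A (ln \<rho>) x" if "x \<notin> H" "\<rho> \<le> norm x" for x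
    proof -
      have "ln \<rho> \<le> ln (norm x)" using \<rho> that by (intro ln_mono) auto
      then show ?thesis using that A by (simp add: log_weight_def)
    qed
    then show "\<exists>\<phi>. test (ln \<rho>) \<phi> \<and> (\<forall>x. 0 \<le> \<phi> x) \<and> (\<forall>x. x \<notin> H \<longrightarrow> \<rho> \<le> norm x \<longrightarrow> ln \<rho> \<le> \<phi> x) \<and> pair t \<phi> \<le> L"
      using test_log_weight[OF A(1) n] log_weight_bounds(1)[OF A(1) n] L[OF n t] by blast
  qed
qed

lemma measure_disc: "0 \<le> r \<Longrightarrow> measure lborel (ball (0 :: real ^ 2) r) = pi * r\<^sup>2"
  by (simp add: content_ball unit_ball_vol_2)

lemma mass_log_decay:
  obtains T B where "4 \<le> T" "0 < B" "\<And>t. T / 2 \<le> t \<Longrightarrow> mass t * ln t \<le> B"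
proof -
  obtain C where C: "0 < C"
    "\<And>t. 0 < t \<Longrightarrow> AE x in lborel. w t x \<le> exp (- (t / 2)) * K + C / t * mass (t / 2)"
    using sup_bound by blast
  obtain L where L: "0 \<le> L" "\<And>\<rho> t. 1 < \<rho> \<Longrightarrow> 0 \<le> t \<Longrightarrow>
      \<exists>\<phi>. test (ln \<rho>) \<phi> \<and> (\<forall>x. 0 \<le> \<phi> x) \<and> (\<forall>x. x \<notin> H \<longrightarrow> \<rho> \<le> norm x \<longrightarrow> ln \<rho> \<le> \<phi> x) \<and> pair t \<phi> \<le> L"
    using log_moment_bound by blast
  \<comment> \<open>Sup times area inside the disc of radius \<open>\<rho>\<close>, Markov's
    inequality with the logarithmic weight outside.\<close>
  have split: "mass t \<le> (exp (- (t / 2)) * K + C / t * mass (t / 2)) * (pi * \<rho>\<^sup>2) + L / ln \<rho>"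
    if t: "0 < t" and \<rho>: "1 < \<rho>" for t \<rho>
  proof -
    define S where "S = exp (- (t / 2)) * K + C / t * mass (t / 2)"
    have t0: "0 \<le> t" using t by simp
    have S: "0 \<le> S" using C t K_pos mass_nonneg[of "t / 2"] unfolding S_def by simp
    obtain \<phi> where \<phi>: "test (ln \<rho>) \<phi>" "\<And>x. 0 \<le> \<phi> x"
      "\<And>x. x \<notin> H \<Longrightarrow> \<rho> \<le> norm x \<Longrightarrow> ln \<rho> \<le> \<phi> x" "pair t \<phi> \<le> L"
      using L(2)[OF \<rho> t0] by blast
    have ln: "0 < ln \<rho>" using \<rho> by simp
    have ib: "integrable lborel (\<lambda>x. S * indicator (ball (0 :: real ^ 2) \<rho>) x)"
      by (intro integrable_mult_right integrable_real_indicator emeasure_lborel_ball_finite) auto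
    have i\<phi>: "integrable lborel (\<lambda>x. w t x * \<phi> x / ln \<rho>)"
      using pair_integrable[OF t0 \<phi>(1)] by simp
    have "mass t \<le> (LINT x|lborel. S * indicator (ball 0 \<rho>) x + w t x * \<phi> x / ln \<rho>)"
      unfolding mass_def
    proof (rule integral_mono_AE[OF w_integrable[OF t0]])
      show "integrable lborel (\<lambda>x. S * indicator (ball 0 \<rho>) x + w t x * \<phi> x / ln \<rho>)"
        using ib i\<phi> by simp
      show "AE x in lborel. w t x \<le> S * indicator (ball 0 \<rho>) x + w t x * \<phi> x / ln \<rho>"
        using w_nonneg[OF t0] w_zero[OF t0] C(2)[OF t]
      proof eventually_elim
        case (elim x)
        have p: "0 \<le> w t x * \<phi> x / ln \<rho>" using elim \<phi>(2) ln by simp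
        consider "x \<in> H" | "x \<notin> H" "norm x < \<rho>" | "x \<notin> H" "\<rho> \<le> norm x" by linarith
        then show ?case
        proof cases
          case 1
          then show ?thesis using elim S p by (simp add: indicator_def)
        next
          case 2
          then show ?thesis using elim p by (simp add: S_def)
        next
          case 3
          have "w t x * ln \<rho> \<le> w t x * \<phi> x" using 3 elim by (intro mult_left_mono \<phi>(3)) auto
          then show ?thesis using 3 ln by (simp add: field_simps)
        qed
      qed
    qed
    also have "\<dots> = S * (pi * \<rho>\<^sup>2) + pair t \<phi> / ln \<rho>"
      using ib i\<phi> \<rho> by (simp add: pair_def measure_disc)
    also have "\<dots> \<le> S * (pi * \<rho>\<^sup>2) + L / ln \<rho>"
      using \<phi>(4) ln by (intro add_left_mono divide_right_mono) auto
    finally show ?thesis by (simp add: S_def)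
  qed
  \<comment> \<open>Then \<open>C / t * (pi * \<rho>\<^sup>2) = 1 / 4\<close> for
    \<open>\<rho>\<^sup>2 = \<delta> * t\<close>.\<close>
  define \<delta> where "\<delta> = 1 / (4 * pi * C)"
  have \<delta>: "0 < \<delta>" using C by (simp add: \<delta>_def)
  \<comment> \<open>\<open>t \<ge> 1 / \<delta>\<^sup>2\<close> gives
    \<open>t \<le> (\<delta> * t)\<^sup>2\<close>, hence \<open>ln t \<le> 4 * ln \<rho>\<close>; 4
    is the threshold of \<open>ln_le_twice_ln_half\<close>.\<close>
  define T where "T = max 4 (1 / \<delta>\<^sup>2)"
  \<comment> \<open>The summands bound the exponential part and the part outside the disc, both
    multiplied by \<open>ln t\<close>.\<close>
  define Q where "Q = 8 * K * pi * \<delta> + 4 * L"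
  have T: "4 \<le> T" "1 / \<delta>\<^sup>2 \<le> T" by (auto simp: T_def)
  have rec: "mass t * ln t \<le> mass (t / 2) * ln (t / 2) / 2 + Q" if t: "T \<le> t" for t
  proof -
    have t4: "4 \<le> t" using t T by simp
    have lnt: "1 \<le> ln t" "ln t \<le> t"
    proof -
      have "exp 1 \<le> t" using exp_le t4 by linarith
      then show "1 \<le> ln t" using t4 by (simp add: ln_ge_iff)
      show "ln t \<le> t" using ln_le_minus_one[of t] t4 by simp
    qed
    have "\<delta>\<^sup>2 * (1 / \<delta>\<^sup>2) \<le> \<delta>\<^sup>2 * t"
      using T(2) t by (intro mult_left_mono) auto
    then have "1 \<le> \<delta>\<^sup>2 * t" using \<delta> by simp
    then have "t \<le> (\<delta> * t)\<^sup>2"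
      using mult_right_mono[of 1 "\<delta>\<^sup>2 * t" t] t4 by (simp add: power2_eq_square mult_ac)
    then have "ln t \<le> ln ((\<delta> * t)\<^sup>2)" using t4 by (intro ln_mono) auto
    also have "\<dots> = 2 * ln (\<delta> * t)" using \<delta> t4 by (simp add: ln_realpow)
    finally have half: "ln t \<le> 2 * ln (\<delta> * t)" .
    define \<rho> where "\<rho> = sqrt (\<delta> * t)"
    have dt: "1 < \<delta> * t"
    proof (rule ccontr)
      assume "\<not> 1 < \<delta> * t"
      then have "ln (\<delta> * t) \<le> 0" using \<delta> t4 by (subst ln_le_zero_iff) auto
      then show False using half lnt by linarith
    qed
    have \<rho>: "1 < \<rho>" "\<rho>\<^sup>2 = \<delta> * t" "ln \<rho> = ln (\<delta> * t) / 2"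
      using dt by (auto simp: \<rho>_def ln_sqrt)
    have "L / ln \<rho> * ln t \<le> 4 * L"
    proof -
      have "L * ln t \<le> L * (4 * ln \<rho>)" using half L(1) unfolding \<rho>(3) by (intro mult_left_mono) auto
      moreover have "0 < ln \<rho>" using \<rho>(1) by simp
      ultimately show ?thesis by (simp add: field_simps)
    qed
    moreover have "exp (- (t / 2)) * K * (pi * (\<delta> * t)) * ln t \<le> 8 * K * pi * \<delta>"
    proof -
      have "exp (- (t / 2)) * (K * pi * \<delta> * (t * ln t)) \<le> 8 / t\<^sup>2 * (K * pi * \<delta> * (t * t))"
        using lnt t4 \<delta> K_pos by (intro mult_mono exp_minus_half_le mult_left_mono) auto
      also have "\<dots> = 8 * K * pi * \<delta>" using t4 by (simp add: power2_eq_square)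
      finally show ?thesis by (simp add: mult_ac)
    qed
    moreover have "C / t * mass (t / 2) * (pi * (\<delta> * t)) * ln t \<le> mass (t / 2) * ln (t / 2) / 2"
    proof -
      have "C / t * mass (t / 2) * (pi * (\<delta> * t)) * ln t = mass (t / 2) * ln t / 4"
        using C t4 by (simp add: \<delta>_def)
      also have "\<dots> \<le> mass (t / 2) * (2 * ln (t / 2)) / 4"
      proof -
        have "ln t \<le> 2 * ln (t / 2)" by (rule ln_le_twice_ln_half[OF t4])
        then show ?thesis using mass_nonneg[of "t / 2"] t4 by (intro divide_right_mono mult_left_mono) auto
      qed
      also have "\<dots> = mass (t / 2) * ln (t / 2) / 2" by simp
      finally show ?thesis .
    qed
    moreover have "mass t * ln t \<le> ((exp (- (t / 2)) * K + C / t * mass (t / 2)) * (pi * (\<delta> * t)) + L / ln \<rho>) * ln t"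
      using split[OF _ \<rho>(1), of t] t4 lnt unfolding \<rho>(2) by (intro mult_right_mono) auto
    ultimately show ?thesis by (simp add: Q_def distrib_right)
  qed
  \<comment> \<open>The added 1 makes the final bound positive.\<close>
  define B0 where "B0 = mass 0 * ln T + 1"
  have "mass t * ln t \<le> B0" if "T / 2 \<le> t" "t \<le> T" for t
  proof -
    have "mass t * ln t \<le> mass 0 * ln T"
      using that T mass_antimono[of 0 t] mass_nonneg[of 0] by (intro mult_mono) auto
    then show ?thesis by (simp add: B0_def)
  qed
  then have "mass t * ln t \<le> max B0 (2 * Q)" if "T / 2 \<le> t" for t
    using T that by (intro halving_bound[of T "\<lambda>t. mass t * ln t"] rec) auto
  moreover have "0 < max B0 (2 * Q)"
  proof -
    have "0 \<le> mass 0 * ln T" using T mass_nonneg[of 0] by simp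
    then show ?thesis by (simp add: B0_def less_max_iff_disj)
  qed
  ultimately show thesis using T by (intro that)
qed

lemma sup_decay:
  obtains T C where "1 < T" "0 < C" "\<And>t. T \<le> t \<Longrightarrow> AE x in lborel. w t x \<le> C / (t * ln t)"
proof -
  obtain C where C: "0 < C"
    "\<And>t. 0 < t \<Longrightarrow> AE x in lborel. w t x \<le> exp (- (t / 2)) * K + C / t * mass (t / 2)"
    using sup_bound by blast
  obtain T B where TB: "4 \<le> T" "0 < B" "\<And>t. T / 2 \<le> t \<Longrightarrow> mass t * ln t \<le> B"
    using mass_log_decay by blast
  show thesis
  \<comment> \<open>\<open>8 * K\<close> comes from \<open>exp_minus_half_le\<close> and
    \<open>ln t \<le> t\<close>; \<open>2 * C * B\<close> from the mass bound at
    \<open>t / 2\<close>, which is why that bound starts at \<open>T / 2\<close>.\<close>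
  proof (rule that[of T "8 * K + 2 * C * B"])
    fix t assume t: "T \<le> t"
    then have t4: "4 \<le> t" using TB by simp
    have ln: "0 < ln t" "ln t \<le> t" using ln_le_minus_one[of t] t4 by auto
    have "exp (- (t / 2)) * K \<le> 8 / (t * ln t) * K"
    proof (rule mult_right_mono)
      have "exp (- (t / 2)) \<le> 8 / (t * t)" using exp_minus_half_le[of t] t4 by (simp add: power2_eq_square)
      also have "\<dots> \<le> 8 / (t * ln t)" using ln t4 by (intro divide_left_mono mult_left_mono) auto
      finally show "exp (- (t / 2)) \<le> 8 / (t * ln t)" .
    qed (use K_pos in simp)
    moreover have "C / t * mass (t / 2) \<le> C / t * (2 * B / ln t)"
    proof (rule mult_left_mono)
      have "ln t \<le> 2 * ln (t / 2)" by (rule ln_le_twice_ln_half[OF t4])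
      then have "mass (t / 2) * ln t \<le> mass (t / 2) * (2 * ln (t / 2))"
        using mass_nonneg[of "t / 2"] t4 by (intro mult_left_mono) auto
      also have "\<dots> \<le> 2 * B" using TB(3)[of "t / 2"] t by simp
      finally show "mass (t / 2) \<le> 2 * B / ln t" using ln by (simp add: field_simps)
    qed (use C t4 in simp)
    ultimately have "exp (- (t / 2)) * K + C / t * mass (t / 2) \<le> (8 * K + 2 * C * B) / (t * ln t)"
      by (simp add: add_divide_distrib mult_ac)
    then show "AE x in lborel. w t x \<le> (8 * K + 2 * C * B) / (t * ln t)"
      using C(2)[of t] t4 by (auto elim!: eventually_mono)
  qed (use TB K_pos C in \<open>auto intro!: add_pos_pos\<close>)
qed

end

section \<open>Representatives of the solution\<close>

lemma C2_compact_support_continuous: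
  assumes "C2_compact_support f"
  shows "continuous_on UNIV f"
proof -
  obtain f' where "\<And>x. (f has_derivative blinfun_apply (f' x)) (at x)"
    using assms unfolding C2_compact_support_def by blast
  then show ?thesis
    by (intro continuous_at_imp_continuous_on) (auto intro: has_derivative_continuous)
qed

text \<open>Functions measurable for the completed measure are replaced by Borel ones, to which the
  product measure arguments on \<open>lborel\<close> apply.\<close>

lemma borel_representatives:
  fixes u :: "real \<Rightarrow> 'a::euclidean_space \<Rightarrow> real"
  assumes "\<And>t. 0 \<le> t \<Longrightarrow> integrable lebesgue (u t)"
  shows "\<exists>w. \<forall>t\<ge>0. integrable lborel (w t) \<and> (AE x in lborel. u t x = w t x)"
proof -
  have "\<exists>g. 0 \<le> t \<longrightarrow> integrable lborel g \<and> (AE x in lborel. u t x = g x)" for t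
  proof (cases "0 \<le> t")
    case True
    then have u: "u t \<in> borel_measurable lebesgue" using assms[of t] by auto
    obtain g where g: "g \<in> borel_measurable lborel" "AE x in lborel. u t x = g x"
      using completion_ex_borel_measurable_real[OF u] by auto
    have "integrable lebesgue g"
      using integrable_cong_AE_imp[OF assms[OF True] measurable_completion[OF g(1)]] AE_completion[OF g(2)]
      by (auto simp: eq_commute)
    then have "integrable lborel g" using g(1) by (simp add: integrable_completion)
    with g show ?thesis by blast
  qed auto
  then show ?thesis by (intro choice allI)
qed

lemma L1_norm_on_cong_AE:
  assumes "AE x in lborel. x \<in> A \<longrightarrow> f x = g x"
  shows "L1_norm_on A f = (\<integral>\<^sup>+x\<in>A. ennreal \<bar>g x\<bar> \<partial>lborel)"
  unfolding L1_norm_on_def nn_integral_completion using assms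
  by (intro nn_integral_cong_AE) (auto simp: indicator_def elim!: eventually_mono)

text \<open>Holds at every \<open>x\<close>: the integral does not see the null set where
  \<open>u\<close> and \<open>w\<close> differ.\<close>

lemma convolve_cong_AE:
  fixes J :: "'a::euclidean_space \<Rightarrow> real"
  assumes J: "J \<in> borel_measurable borel" and w: "w \<in> borel_measurable borel"
    and u: "u \<in> borel_measurable lebesgue" and eq: "AE x in lborel. u x = w x"
  shows "convolve J u x = (LINT y|lborel. J (x - y) * w y)"
proof -
  have Jm: "(\<lambda>y. J (x - y)) \<in> borel_measurable lborel"
    using measurable_compose[OF _ J, of "\<lambda>y. x - y" lborel] by simp
  have "convolve J u x = (LINT y|lebesgue. J (x - y) * w y)"
    unfolding convolve_def
  proof (rule integral_cong_AE)
    show "AE y in lebesgue. J (x - y) * u y = J (x - y) * w y"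
      using AE_completion[OF eq] by eventually_elim simp
    show "(\<lambda>y. J (x - y) * u y) \<in> borel_measurable lebesgue"
      by (rule borel_measurable_times[OF measurable_completion[OF Jm] u])
    have "w \<in> borel_measurable lborel" using w by simp
    then show "(\<lambda>y. J (x - y) * w y) \<in> borel_measurable lebesgue"
      by (intro borel_measurable_times measurable_completion Jm)
  qed
  also have "\<dots> = (LINT y|lborel. J (x - y) * w y)"
    using Jm w by (intro integral_completion) auto
  finally show ?thesis .
qed

lemma solves_exterior_problem_representatives:
  assumes sol: "solves_exterior_problem J H u0 u" and J: "J \<in> borel_measurable borel"
    and u0: "AE x in lebesgue. x \<in> H \<longrightarrow> u0 x = 0"
  shows "\<exists>w. (\<forall>t\<ge>0. integrable lborel (w t) \<and> (AE x in lborel. u t x = w t x) \<and>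
        (AE x in lborel. x \<in> H \<longrightarrow> w t x = 0) \<and>
        ((\<lambda>s. \<integral>\<^sup>+x. ennreal \<bar>w s x - w t x\<bar> \<partial>lborel) \<longlongrightarrow> 0) (at t within {0..})) \<and>
      (\<forall>t>0. ((\<lambda>h. \<integral>\<^sup>+x\<in>-H. ennreal \<bar>(w (t + h) x - w t x) / h -
        ((LINT y|lborel. J (x - y) * w t y) - w t x)\<bar> \<partial>lborel) \<longlongrightarrow> 0) (at 0))"
proof -
  have int: "integrable lebesgue (u t)"
    and cont: "((\<lambda>s. L1_norm_on UNIV (\<lambda>x. u s x - u t x)) \<longlongrightarrow> 0) (at t within {0..})" if "0 \<le> t" for t
    using sol that unfolding solves_exterior_problem_def L1_continuous_curve_def by blast+
  have deriv: "((\<lambda>h. L1_norm_on (- H) (\<lambda>x. (u (t + h) x - u t x) / h - nonlocal_op J (u t) x)) \<longlongrightarrow> 0) (at 0)"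
    and zero: "AE x in lborel. x \<in> H \<longrightarrow> u t x = 0" if "0 < t" for t
    using sol that unfolding solves_exterior_problem_def has_L1_time_derivative_on_def AE_completion_iff by blast+
  have init: "AE x in lborel. u 0 x = u0 x"
    using sol unfolding solves_exterior_problem_def AE_completion_iff by blast
  obtain w where "\<forall>t\<ge>0. integrable lborel (w t) \<and> (AE x in lborel. u t x = w t x)"
    using borel_representatives[of u] int by blast
  then have w: "integrable lborel (w t)" and uw: "AE x in lborel. u t x = w t x" if "0 \<le> t" for t
    using that by blast+
  show ?thesis
  proof (intro exI[of _ w] conjI allI impI w uw)
    fix t :: real assume t: "0 \<le> t"
    \<comment> \<open>The condition in the hole is stated for \<open>t > 0\<close>; at time 0 it is
      inherited from the datum.\<close>
    have "AE x in lborel. x \<in> H \<longrightarrow> u t x = 0"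
    proof (cases "t = 0")
      case True
      have "AE x in lborel. x \<in> H \<longrightarrow> u0 x = 0" using u0 by (simp add: AE_completion_iff)
      with init show ?thesis unfolding True by eventually_elim auto
    qed (use zero t in auto)
    with uw[OF t] show "AE x in lborel. x \<in> H \<longrightarrow> w t x = 0" by eventually_elim auto
    have "L1_norm_on UNIV (\<lambda>x. u s x - u t x) = (\<integral>\<^sup>+x. ennreal \<bar>w s x - w t x\<bar> \<partial>lborel)" if "0 \<le> s" for s
    proof -
      have "AE x in lborel. u s x - u t x = w s x - w t x"
        using uw[OF t] uw[OF that] by eventually_elim simp
      then show ?thesis by (subst L1_norm_on_cong_AE[where g = "\<lambda>x. w s x - w t x"]) auto
    qed
    then show "((\<lambda>s. \<integral>\<^sup>+x. ennreal \<bar>w s x - w t x\<bar> \<partial>lborel) \<longlongrightarrow> 0) (at t within {0..})"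
      by (intro Lim_transform_eventually[OF cont[OF t]]) (auto simp: eventually_at_filter)
  next
    fix t :: real assume t: "0 < t"
    then have t0: "0 \<le> t" by simp
    have conv: "convolve J (u t) x = (LINT y|lborel. J (x - y) * w t y)" for x
      using J w[OF t0] int[OF t0] uw[OF t0] by (intro convolve_cong_AE) auto
    have eq: "L1_norm_on (- H) (\<lambda>x. (u (t + h) x - u t x) / h - nonlocal_op J (u t) x) =
        (\<integral>\<^sup>+x\<in>-H. ennreal \<bar>(w (t + h) x - w t x) / h - ((LINT y|lborel. J (x - y) * w t y) - w t x)\<bar> \<partial>lborel)"
      if "0 \<le> t + h" for h
    proof (rule L1_norm_on_cong_AE)
      show "AE x in lborel. x \<in> - H \<longrightarrow> (u (t + h) x - u t x) / h - nonlocal_op J (u t) x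
        = (w (t + h) x - w t x) / h - ((LINT y|lborel. J (x - y) * w t y) - w t x)"
        using uw[OF t0] uw[OF that] by eventually_elim (simp add: nonlocal_op_def conv)
    qed
    \<comment> \<open>Representatives are chosen for nonnegative times, so the norms agree
      eventually as \<open>h\<close> tends to 0.\<close>
    have "\<forall>\<^sub>F h in at 0. 0 \<le> t + h"
      unfolding eventually_at using t by (auto intro!: exI[of _ t] simp: dist_norm)
    then show "((\<lambda>h. \<integral>\<^sup>+x\<in>-H. ennreal \<bar>(w (t + h) x - w t x) / h -
        ((LINT y|lborel. J (x - y) * w t y) - w t x)\<bar> \<partial>lborel) \<longlongrightarrow> 0) (at 0)"
      by (intro Lim_transform_eventually[OF deriv[OF t]]) (auto elim!: eventually_mono simp: eq)
  qed
qed

theorem proposition3p3: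
  fixes H :: "(real ^ 2) set" and R d :: real
    and J u0 :: "real ^ 2 \<Rightarrow> real" and u :: "real \<Rightarrow> real ^ 2 \<Rightarrow> real"
  assumes "H \<noteq> {}" and "bounded H" and "open H"
    and "2 < R" and "ball 0 2 \<subseteq> H" and "H \<subseteq> ball 0 R"
    and "C2_compact_support J" and "radially_symmetric J"
    and "0 < d"
    and "\<And>x. norm x < d \<Longrightarrow> 0 < J x"
    and "\<And>x. d \<le> norm x \<Longrightarrow> J x = 0"
    and "(LINT x|lebesgue. J x) = 1"
    and "AE x in lebesgue. 0 \<le> u0 x"
    and "AE x in lebesgue. x \<in> H \<longrightarrow> u0 x = 0"
    and "essentially_bounded u0" and "log_weighted_integrable u0"
    and "solves_exterior_problem J H u0 u"
  shows "\<exists>t0 C1. 1 < t0 \<and> 0 < C1 \<and>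
           (\<forall>t\<ge>t0. AE x in lebesgue. u t x \<le> C1 / (t * ln t))"
proof -
  have J_cont: "continuous_on UNIV J" by (rule C2_compact_support_continuous) fact
  have [measurable]: "J \<in> borel_measurable borel" by (rule borel_measurable_continuous_onI[OF J_cont])
  have J_int: "(LINT x|lborel. J x) = 1"
    using \<open>(LINT x|lebesgue. J x) = 1\<close> by (subst (asm) integral_completion) auto
  obtain w where w_0: "\<forall>t\<ge>0. integrable lborel (w t) \<and> (AE x in lborel. u t x = w t x) \<and>
        (AE x in lborel. x \<in> H \<longrightarrow> w t x = 0) \<and>
        ((\<lambda>s. \<integral>\<^sup>+x. ennreal \<bar>w s x - w t x\<bar> \<partial>lborel) \<longlongrightarrow> 0) (at t within {0..})"
    and w_deriv: "\<forall>t>0. ((\<lambda>h. \<integral>\<^sup>+x\<in>-H. ennreal \<bar>(w (t + h) x - w t x) / h -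
        ((LINT y|lborel. J (x - y) * w t y) - w t x)\<bar> \<partial>lborel) \<longlongrightarrow> 0) (at 0)"
    using solves_exterior_problem_representatives[OF assms(17) \<open>J \<in> borel_measurable borel\<close> assms(14)] by blast
  have w: "integrable lborel (w t)"
    and uw: "AE x in lborel. u t x = w t x"
    and wH: "AE x in lborel. x \<in> H \<longrightarrow> w t x = 0"
    and w_cont: "((\<lambda>s. \<integral>\<^sup>+x. ennreal \<bar>w s x - w t x\<bar> \<partial>lborel) \<longlongrightarrow> 0) (at t within {0..})" if "0 \<le> t" for t
    using w_0 that by blast+
  have [measurable]: "w 0 \<in> borel_measurable borel" using borel_measurable_integrable[OF w[of 0]] by simp
  have w0: "AE x in lborel. w 0 x = u0 x"
  proof -
    have "AE x in lborel. u 0 x = u0 x"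
      using assms(17) by (auto simp: solves_exterior_problem_def AE_completion_iff)
    with uw[OF order_refl] show ?thesis by eventually_elim simp
  qed
  obtain M where M: "AE x in lborel. \<bar>u0 x\<bar> \<le> M"
    using \<open>essentially_bounded u0\<close> by (auto simp: essentially_bounded_def AE_completion_iff)
  \<comment> \<open>The locale asks for a positive sup bound, hence \<open>max M 1\<close>.\<close>
  interpret radial_exterior_solution J d H w "max M 1"
  proof
    show "0 < J x" if "norm x < d" for x by (rule assms(10)[OF that])
    show "J x = 0" if "d \<le> norm x" for x by (rule assms(11)[OF that])
    show "J x = J y" if "norm x = norm y" for x y
      using \<open>radially_symmetric J\<close> that unfolding radially_symmetric_def by blast
    show "H \<in> sets borel" using \<open>open H\<close> by simp
    have "AE x in lborel. 0 \<le> u0 x"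
      using assms(13) by (simp add: AE_completion_iff)
    with w0 show "AE x in lborel. 0 \<le> w 0 x" by eventually_elim simp
    show "AE x in lborel. w 0 x \<le> max M 1"
      using w0 M by eventually_elim auto
    have "integrable lebesgue (\<lambda>x. w 0 x * ln (norm x))"
    proof (rule integrable_cong_AE_imp)
      show "integrable lebesgue (\<lambda>x. u0 x * ln (norm x))"
        using \<open>log_weighted_integrable u0\<close> by (simp add: log_weighted_integrable_def)
      show "(\<lambda>x. w 0 x * ln (norm x)) \<in> borel_measurable lebesgue"
        by (rule measurable_completion) measurable
      show "AE x in lebesgue. u0 x * ln (norm x) = w 0 x * ln (norm x)"
        using AE_completion[OF w0] by eventually_elim simp
    qed
    then show "integrable lborel (\<lambda>x. w 0 x * ln (norm x))"
      by (subst (asm) integrable_completion) auto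
    show "0 < max M 1" by simp
  qed (rule J_cont J_int assms(5,9) w wH w_cont w_deriv[rule_format]; assumption)+
  obtain T C where "1 < T" "0 < C" "\<And>t. T \<le> t \<Longrightarrow> AE x in lborel. w t x \<le> C / (t * ln t)"
    using sup_decay by blast
  moreover have "AE x in lebesgue. u t x \<le> C / (t * ln t)" if "T \<le> t" for t
  proof (rule AE_completion)
    have "0 \<le> t" using that \<open>1 < T\<close> by simp
    from uw[OF this] show "AE x in lborel. u t x \<le> C / (t * ln t)"
      using calculation(3)[OF that] by eventually_elim simp
  qed
  ultimately show ?thesis by blast
qed

end
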